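(* Let $E$ and $G$ be two Banach function spaces and let $T \in M(E,G)$. If $Y$ is a reflexive Banach space, then the $Y$-valued extension $T_{Y} \in \mathcal{L}(E(Y),G(Y))$ of $T$ with respect to $\langle Y^{*},Y\rangle$ exists, i.e. there exists a (necessarily unique) bounded linear operator $T_{Y}\in\mathcal{L}(E(Y),G(Y))$ such that \[ \langle y^{*},T_{Y}e\rangle = T\langle y^{*},e\rangle \quad\text{for all } e\in E(Y),\ y^{*}\in Y^{*}, \] and it satisfies $\|T_{Y}\| \leq \|T\|_{M(E,G)}$.
   Context: All spaces are over a fixed field $\mathbb{K}\in\{\mathbb{R},\mathbb{C}\}$. $\mathcal{L}(V,W)$ denotes the bounded linear operators from $V$ to $W$. Function spaces. For a measure space $(A,\mathscr{A},\mu)$, $L^{0}(A)$ is the Riesz space of $\mu$-a.e. equivalence classes of measurable functions $A\to\mathbb{K}$, and for a Banach space $Y$, $L^{0}(A;Y)$ is the space of $\mu$-a.e. classes of strongly measurable functions $A\to Y$ (pointwise limits of sequences of $Y$-valued step functions). A Banach function space on $(A,\mathscr{A},\mu)$ is an order ideal $E$ of $L^{0}(A)$ equipped with a (complete) Banach lattice norm. The two Banach function spaces $E$ and $G$ may live on different, arbitrary measure spaces. The Köthe-Bochner space is $E(Y)=\{f\in L^{0}(A;Y): \|f\|_{Y}\in E\}$ with norm $\|f\|=\big\|\,\|f\|_{Y}\big\|_{E}$, where $\|f\|_Y$ denotes the function $a\mapsto\|f(a)\|_Y$. For $e\in E(Y)$ and $y^{*}\in Y^{*}$, $\langle y^{*},e\rangle\in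 E$ denotes the function $a\mapsto\langle y^{*},e(a)\rangle$. Dominated operators. A linear operator $T:E\to G$ between Banach lattices is dominated by a positive operator $R\in\mathcal{L}(E,G)$ if $|Te|\le R|e|$ for all $e\in E$. $M(E,G)\subset\mathcal{L}(E,G)$ is the set of all linear operators dominated by some positive operator, and $\|T\|_{M(E,G)}=\inf\{\|R\|: R \text{ positive and dominating } T\}$. *)

theory Defs
  imports "HOL-Analysis.Analysis"
begin

text \<open>
  The type class of scalar fields contains, up to isometric isomorphism, exactly
  \<open>\<real>\<close> and \<open>\<complex>\<close>, so that the real and the complex theory are treated uniformly.
  (In the axiom, \<open>r *\<^sub>R 1\<close> is \<open>of_real r\<close>, which is not available within the class.)
\<close>

class real_or_complex = real_normed_field +
  assumes real_or_complex:
    "range (\<lambda>r::real. r *\<^sub>R 1) = (UNIV :: 'a set) \<or>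
     (\<exists>\<phi>::complex \<Rightarrow> 'a. bij \<phi> \<and> (\<forall>z w. \<phi> (z + w) = \<phi> z + \<phi> w) \<and>
        (\<forall>z w. \<phi> (z * w) = \<phi> z * \<phi> w) \<and> (\<forall>r. \<phi> (of_real r) = r *\<^sub>R 1) \<and>
        (\<forall>z. norm (\<phi> z) = norm z))"

instance real :: real_or_complex
  by standard (simp add: surj_def)

instance complex :: real_or_complex
proof
  show "range (\<lambda>r. r *\<^sub>R (1::complex)) = UNIV \<or>
     (\<exists>\<phi>::complex \<Rightarrow> complex. bij \<phi> \<and> (\<forall>z w. \<phi> (z + w) = \<phi> z + \<phi> w) \<and>
        (\<forall>z w. \<phi> (z * w) = \<phi> z * \<phi> w) \<and> (\<forall>r. \<phi> (of_real r) = r *\<^sub>R 1) \<and>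
        (\<forall>z. norm (\<phi> z) = norm z))"
    by (intro disjI2 exI[of _ id]) (simp add: scaleR_conv_of_real)
qed

text \<open>
  A Banach space over \<open>'k\<close>: the class \<open>banach\<close> supplies the norm, completeness and the
  underlying real vector space, with which the scalar multiplication has to be compatible.
\<close>

locale banach_space_over = vector_space sc
  for sc :: "'k::real_or_complex \<Rightarrow> 'y::banach \<Rightarrow> 'y" +
  assumes scale_of_real: "sc (of_real r) y = r *\<^sub>R y"
    and norm_scale: "norm (sc c y) = norm c * norm y"

definition dual_space :: "('k::real_or_complex \<Rightarrow> 'y::banach \<Rightarrow> 'y) \<Rightarrow> ('y \<Rightarrow> 'k) set" where
  "dual_space sc = {f. bounded_linear f \<and> (\<forall>c y. f (sc c y) = c * f y)}"

text \<open>Elements of the bidual are only determined on \<open>dual_space sc\<close>.\<close>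

definition bidual_space ::
    "('k::real_or_complex \<Rightarrow> 'y::banach \<Rightarrow> 'y) \<Rightarrow> (('y \<Rightarrow> 'k) \<Rightarrow> 'k) set" where
  "bidual_space sc = {\<phi>.
     (\<forall>f\<in>dual_space sc. \<forall>g\<in>dual_space sc. \<phi> (\<lambda>y. f y + g y) = \<phi> f + \<phi> g) \<and>
     (\<forall>c. \<forall>f\<in>dual_space sc. \<phi> (\<lambda>y. c * f y) = c * \<phi> f) \<and>
     (\<exists>C. \<forall>f\<in>dual_space sc. norm (\<phi> f) \<le> C * onorm f)}"

definition reflexive_space :: "('k::real_or_complex \<Rightarrow> 'y::banach \<Rightarrow> 'y) \<Rightarrow> bool" where
  "reflexive_space sc \<longleftrightarrow>
     (\<forall>\<phi>\<in>bidual_space sc. \<exists>y. \<forall>f\<in>dual_space sc. \<phi> f = f y)"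

text \<open>
  Spaces of almost-everywhere classes are represented by sets of measurable (respectively
  strongly measurable) functions; equality of classes is equality almost everywhere. The values
  of a function outside the space of the measure are irrelevant.
\<close>

record ('a, 'v) fun_space =
  fs_measure :: "'a measure"
  fs_carrier :: "('a \<Rightarrow> 'v) set"
  fs_norm :: "('a \<Rightarrow> 'v) \<Rightarrow> real"

definition banach_function_space :: "('a, 'k::real_or_complex) fun_space \<Rightarrow> bool" where
  "banach_function_space E \<longleftrightarrow>
     \<comment> \<open>order ideal of \<open>L\<^sup>0\<close>\<close>
     fs_carrier E \<subseteq> borel_measurable (fs_measure E) \<and>
     (\<lambda>a. 0) \<in> fs_carrier E \<and>
     (\<forall>f\<in>fs_carrier E. \<forall>g\<in>fs_carrier E. (\<lambda>a. f a + g a) \<in> fs_carrier E) \<and>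
     (\<forall>c. \<forall>f\<in>fs_carrier E. (\<lambda>a. c * f a) \<in> fs_carrier E) \<and>
     (\<forall>f\<in>borel_measurable (fs_measure E). \<forall>g\<in>fs_carrier E.
        (AE a in fs_measure E. norm (f a) \<le> norm (g a)) \<longrightarrow> f \<in> fs_carrier E) \<and>
     \<comment> \<open>lattice norm\<close>
     (\<forall>f\<in>fs_carrier E. fs_norm E f = 0 \<longleftrightarrow> (AE a in fs_measure E. f a = 0)) \<and>
     (\<forall>f\<in>fs_carrier E. \<forall>g\<in>fs_carrier E.
        fs_norm E (\<lambda>a. f a + g a) \<le> fs_norm E f + fs_norm E g) \<and>
     (\<forall>c. \<forall>f\<in>fs_carrier E. fs_norm E (\<lambda>a. c * f a) = norm c * fs_norm E f) \<and>
     (\<forall>f\<in>fs_carrier E. \<forall>g\<in>fs_carrier E.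
        (AE a in fs_measure E. norm (f a) \<le> norm (g a)) \<longrightarrow> fs_norm E f \<le> fs_norm E g) \<and>
     \<comment> \<open>completeness\<close>
     (\<forall>u. (\<forall>n::nat. u n \<in> fs_carrier E) \<and>
          (\<forall>\<epsilon>>0. \<exists>K. \<forall>m\<ge>K. \<forall>n\<ge>K. fs_norm E (\<lambda>a. u m a - u n a) < \<epsilon>) \<longrightarrow>
          (\<exists>f\<in>fs_carrier E. (\<lambda>n. fs_norm E (\<lambda>a. u n a - f a)) \<longlonglongrightarrow> 0))"

definition strongly_measurable :: "'a measure \<Rightarrow> ('a \<Rightarrow> 'y::banach) \<Rightarrow> bool" where
  "strongly_measurable M f \<longleftrightarrow>
     (\<exists>s. (\<forall>n. simple_function M (s n)) \<and> (\<forall>a\<in>space M. (\<lambda>n. s n a) \<longlonglongrightarrow> f a))"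

definition abs_fun :: "('a \<Rightarrow> 'v::real_normed_vector) \<Rightarrow> 'a \<Rightarrow> 'k::real_or_complex" where
  "abs_fun f = (\<lambda>a. of_real (norm (f a)))"

definition kothe_bochner ::
    "('a, 'k::real_or_complex) fun_space \<Rightarrow> ('a, 'y::banach) fun_space" where
  "kothe_bochner E =
     \<lparr>fs_measure = fs_measure E,
      fs_carrier = {f. strongly_measurable (fs_measure E) f \<and> abs_fun f \<in> fs_carrier E},
      fs_norm = (\<lambda>f. fs_norm E (abs_fun f))\<rparr>"

text \<open>
  Linear operators between spaces of classes; the first two arguments are the scalar
  multiplications of the value spaces. The second condition says that \<open>T\<close> is well
  defined on classes.
\<close>

definition linear_operator ::
    "('k::real_or_complex \<Rightarrow> 'v::real_normed_vector \<Rightarrow> 'v) \<Rightarrow>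
     ('k \<Rightarrow> 'w::real_normed_vector \<Rightarrow> 'w) \<Rightarrow>
     ('a, 'v) fun_space \<Rightarrow> ('b, 'w) fun_space \<Rightarrow> (('a \<Rightarrow> 'v) \<Rightarrow> 'b \<Rightarrow> 'w) \<Rightarrow> bool" where
  "linear_operator sv sw E G T \<longleftrightarrow>
     (\<forall>f\<in>fs_carrier E. T f \<in> fs_carrier G) \<and>
     (\<forall>f\<in>fs_carrier E. \<forall>g\<in>fs_carrier E. (AE a in fs_measure E. f a = g a) \<longrightarrow>
        (AE b in fs_measure G. T f b = T g b)) \<and>
     (\<forall>f\<in>fs_carrier E. \<forall>g\<in>fs_carrier E.
        AE b in fs_measure G. T (\<lambda>a. f a + g a) b = T f b + T g b) \<and>
     (\<forall>c. \<forall>f\<in>fs_carrier E. AE b in fs_measure G. T (\<lambda>a. sv c (f a)) b = sw c (T f b))"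

definition bounded_operator ::
    "('k::real_or_complex \<Rightarrow> 'v::real_normed_vector \<Rightarrow> 'v) \<Rightarrow>
     ('k \<Rightarrow> 'w::real_normed_vector \<Rightarrow> 'w) \<Rightarrow>
     ('a, 'v) fun_space \<Rightarrow> ('b, 'w) fun_space \<Rightarrow> (('a \<Rightarrow> 'v) \<Rightarrow> 'b \<Rightarrow> 'w) \<Rightarrow> bool" where
  "bounded_operator sv sw E G T \<longleftrightarrow>
     linear_operator sv sw E G T \<and>
     (\<exists>C. \<forall>f\<in>fs_carrier E. fs_norm G (T f) \<le> C * fs_norm E f)"

definition operator_norm ::
    "('a, 'v) fun_space \<Rightarrow> ('b, 'w) fun_space \<Rightarrow> (('a \<Rightarrow> 'v) \<Rightarrow> 'b \<Rightarrow> 'w) \<Rightarrow> real" where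
  "operator_norm E G T = (SUP f\<in>{f\<in>fs_carrier E. fs_norm E f \<le> 1}. fs_norm G (T f))"

text \<open>
  The order on scalars is \<open>z \<le> w\<close> iff \<open>w - z \<in> \<real>\<^sub>\<ge>\<^sub>0\<close>; over the complex numbers a positive
  function is thus in particular real-valued.
\<close>

definition positive_operator ::
    "('a, 'k::real_or_complex) fun_space \<Rightarrow> ('b, 'k) fun_space \<Rightarrow>
     (('a \<Rightarrow> 'k) \<Rightarrow> 'b \<Rightarrow> 'k) \<Rightarrow> bool" where
  "positive_operator E G R \<longleftrightarrow>
     bounded_operator (*) (*) E G R \<and>
     (\<forall>f\<in>fs_carrier E. (AE a in fs_measure E. f a \<in> \<real>\<^sub>\<ge>\<^sub>0) \<longrightarrow>
        (AE b in fs_measure G. R f b \<in> \<real>\<^sub>\<ge>\<^sub>0))"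

definition dominates ::
    "('a, 'k::real_or_complex) fun_space \<Rightarrow> ('b, 'k) fun_space \<Rightarrow>
     (('a \<Rightarrow> 'k) \<Rightarrow> 'b \<Rightarrow> 'k) \<Rightarrow> (('a \<Rightarrow> 'k) \<Rightarrow> 'b \<Rightarrow> 'k) \<Rightarrow> bool" where
  "dominates E G R T \<longleftrightarrow>
     positive_operator E G R \<and>
     (\<forall>e\<in>fs_carrier E. AE b in fs_measure G. R (abs_fun e) b - abs_fun (T e) b \<in> \<real>\<^sub>\<ge>\<^sub>0)"

definition dominated_operators ::
    "('a, 'k::real_or_complex) fun_space \<Rightarrow> ('b, 'k) fun_space \<Rightarrow>
     (('a \<Rightarrow> 'k) \<Rightarrow> 'b \<Rightarrow> 'k) set" where
  "dominated_operators E G = {T. linear_operator (*) (*) E G T \<and> (\<exists>R. dominates E G R T)}"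

definition dominated_norm ::
    "('a, 'k::real_or_complex) fun_space \<Rightarrow> ('b, 'k) fun_space \<Rightarrow>
     (('a \<Rightarrow> 'k) \<Rightarrow> 'b \<Rightarrow> 'k) \<Rightarrow> real" where
  "dominated_norm E G T = (INF R\<in>{R. dominates E G R T}. operator_norm E G R)"

definition vector_valued_extension ::
    "('k::real_or_complex \<Rightarrow> 'y::banach \<Rightarrow> 'y) \<Rightarrow>
     ('a, 'k) fun_space \<Rightarrow> ('b, 'k) fun_space \<Rightarrow> (('a \<Rightarrow> 'k) \<Rightarrow> 'b \<Rightarrow> 'k) \<Rightarrow>
     (('a \<Rightarrow> 'y) \<Rightarrow> 'b \<Rightarrow> 'y) \<Rightarrow> bool" where
  "vector_valued_extension sc E G T S \<longleftrightarrow>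
     bounded_operator sc sc (kothe_bochner E) (kothe_bochner G) S \<and>
     (\<forall>e\<in>fs_carrier (kothe_bochner E). \<forall>f\<in>dual_space sc.
        AE b in fs_measure G. f (S e b) = T (\<lambda>a. f (e a)) b)"

end

theory Submission
  imports Defs
begin

text \<open>
  Let \<open>R\<close> dominate \<open>T\<close> and let \<open>e \<in> E(Y)\<close>; its values lie in a separable closed subspace \<open>Z\<close> of \<open>Y\<close>.
  For almost every \<open>b\<close>, the map \<open>y\<^sup>* \<mapsto> T\<langle>y\<^sup>*, e\<rangle>(b)\<close> is linear on a countable set \<open>H\<close> of functionals and
  bounded there by \<open>R\<bar>e\<bar>(b)\<close> times the norm of \<open>y\<^sup>*\<close> restricted to \<open>Z\<close>. By Hahn-Banach it extends to
  \<open>Y\<^sup>*\<close>, and by reflexivity the extension is evaluation at some \<open>u(b) \<in> Z\<close>. If \<open>H\<close> norms \<open>Z\<close>, reflexivity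
  and Hahn-Banach show that \<open>H\<close> is dense in \<open>Y\<^sup>*\<close> for the norm on \<open>Z\<close>, so that
  \<open>\<langle>y\<^sup>*, u\<rangle> = T\<langle>y\<^sup>*, e\<rangle>\<close> almost everywhere for every \<open>y\<^sup>*\<close>; moreover \<open>u\<close> is strongly measurable, because it is
  separably valued and its distance to a point is a countable supremum of measurable functions.
  Testing against a countable norming set gives uniqueness and \<open>\<parallel>u\<parallel> \<le> R\<bar>e\<bar>\<close> for every dominating \<open>R\<close>.
\<close>

section \<open>The Hahn-Banach theorem\<close>

text \<open>Only an inequality for \<open>t > 0\<close> is demanded; applying it to \<open>t\<close>
  and to its inverse gives equality, and \<open>p 0 = 0\<close> follows. This keeps the verification
  for infima short.\<close>

definition sublinear :: "('v::real_vector \<Rightarrow> real) \<Rightarrow> bool" where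
  "sublinear p \<longleftrightarrow> (\<forall>x y. p (x + y) \<le> p x + p y) \<and> (\<forall>t>0. \<forall>x. p (t *\<^sub>R x) \<le> t * p x)"

lemma sublinear_add: "sublinear p \<Longrightarrow> p (x + y) \<le> p x + p y"
  by (simp add: sublinear_def)

lemma sublinear_0: assumes "sublinear p" shows "p 0 = 0"
proof -
  have "p (0 + 0) \<le> p 0 + p 0" "p ((1/2) *\<^sub>R 0) \<le> (1/2) * p 0"
    using assms unfolding sublinear_def by (blast, meson half_gt_zero zero_less_one)
  then show ?thesis by simp
qed

lemma sublinear_scaleR:
  assumes "sublinear p" "t \<ge> 0" shows "p (t *\<^sub>R x) = t * p x"
proof (cases "t = 0")
  case False
  then have t: "t > 0" using assms by simp
  have "p (inverse t *\<^sub>R (t *\<^sub>R x)) \<le> inverse t * p (t *\<^sub>R x)"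
    using assms t unfolding sublinear_def by (meson positive_imp_inverse_positive)
  then have "p x \<le> p (t *\<^sub>R x) / t" using t by (simp add: field_simps)
  then have "t * p x \<le> p (t *\<^sub>R x)" using t by (simp add: field_simps)
  moreover have "p (t *\<^sub>R x) \<le> t * p x" using assms t by (simp add: sublinear_def)
  ultimately show ?thesis by simp
qed (simp add: sublinear_0 assms)

lemma sublinear_minus: "sublinear p \<Longrightarrow> - p (- x) \<le> p x"
  using sublinear_add[of p x "- x"] by (simp add: sublinear_0)

text \<open>\<open>q\<close> is the infimum of \<open>p (x + w) - c\<close> over the convex cone
  \<open>W\<close>; it is finite because \<open>c \<le> p w\<close> gives the lower bound
  \<open>- p (- x)\<close>. It is used with a ray to show that minimal sublinear functions are
  additive, and with a graph to prescribe values.\<close>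

lemma sublinear_lower_cone:
  fixes p :: "'v::real_vector \<Rightarrow> real" and W :: "('v \<times> real) set"
  assumes p: "sublinear p" and ne: "W \<noteq> {}"
    and add: "\<And>u v. u \<in> W \<Longrightarrow> v \<in> W \<Longrightarrow> u + v \<in> W"
    and scale: "\<And>t u. t > 0 \<Longrightarrow> u \<in> W \<Longrightarrow> t *\<^sub>R u \<in> W"
    and le: "\<And>w c. (w, c) \<in> W \<Longrightarrow> c \<le> p w"
  obtains q where "sublinear q" "\<And>x w c. (w, c) \<in> W \<Longrightarrow> q x \<le> p (x + w) - c"
proof -
  define k where "k = (\<lambda>x (u :: 'v \<times> real). p (x + fst u) - snd u)"
  define q where "q = (\<lambda>x. INF u\<in>W. k x u)"
  have "- p (- x) \<le> k x u" if "u \<in> W" for x u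
    using le[of "fst u" "snd u"] that sublinear_add[OF p, of "x + fst u" "- x"] by (simp add: k_def)
  then have bdd: "bdd_below (k x ` W)" for x by (auto intro!: bdd_belowI[of _ "- p (- x)"])
  have qk: "q x \<le> k x u" if "u \<in> W" for x u
    unfolding q_def using bdd that by (rule cINF_lower)
  have sub: "sublinear q"
    unfolding sublinear_def
  proof (intro conjI allI impI)
    fix x y
    \<comment> \<open>The sum of two infima is handled one variable at a time: first
      \<open>v\<close> varies with \<open>u\<close> fixed, then \<open>u\<close> varies.\<close>
    have "q (x + y) - k x u \<le> q y" if u: "u \<in> W" for u
      unfolding q_def
    proof (rule cINF_greatest[OF ne])
      fix v assume v: "v \<in> W"
      have "q (x + y) \<le> k (x + y) (u + v)" using qk add u v by blast
      also have "\<dots> \<le> k x u + k y v"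
        using sublinear_add[OF p, of "x + fst u" "y + fst v"] by (simp add: k_def algebra_simps)
      finally show "(INF u\<in>W. k (x + y) u) - k x u \<le> k y v" by (simp add: q_def)
    qed
    then have "q (x + y) - q y \<le> k x u" if "u \<in> W" for u using that by (simp add: algebra_simps)
    then have "q (x + y) - q y \<le> q x" unfolding q_def by (intro cINF_greatest[OF ne])
    then show "q (x + y) \<le> q x + q y" by simp
  next
    fix t :: real and x assume t: "t > 0"
    have "q (t *\<^sub>R x) / t \<le> q x"
      unfolding q_def
    proof (rule cINF_greatest[OF ne])
      fix u assume u: "u \<in> W"
      have "q (t *\<^sub>R x) \<le> k (t *\<^sub>R x) (t *\<^sub>R u)" using qk scale t u by blast
      also have "\<dots> = t * k x u"
        using sublinear_scaleR[OF p, of t "x + fst u"] t by (simp add: k_def algebra_simps)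
      finally show "(INF u\<in>W. k (t *\<^sub>R x) u) / t \<le> k x u" using t by (simp add: q_def field_simps)
    qed
    then show "q (t *\<^sub>R x) \<le> t * q x" using t by (simp add: field_simps)
  qed
  show ?thesis
  proof (rule that[OF sub])
    show "q x \<le> p (x + w) - c" if "(w, c) \<in> W" for x w c using qk[OF that] by (simp add: k_def)
  qed
qed

text \<open>Subadditivity needs one member of \<open>C\<close> below both \<open>q\<close> and
  \<open>r\<close>, which a chain provides. The bound \<open>p\<close> keeps the pointwise infimum
  finite, since \<open>- p (- x) \<le> - q (- x) \<le> q x\<close>.\<close>

lemma sublinear_INF_chain:
  assumes "C \<noteq> {}" and sub: "\<And>q. q \<in> C \<Longrightarrow> sublinear q" and le: "\<And>q x. q \<in> C \<Longrightarrow> q x \<le> p x"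
    and chain: "\<And>q r. q \<in> C \<Longrightarrow> r \<in> C \<Longrightarrow> q \<le> r \<or> r \<le> q"
  shows "sublinear (\<lambda>x. INF q\<in>C. q x)" and "\<And>q x. q \<in> C \<Longrightarrow> (INF q\<in>C. q x) \<le> q x"
proof -
  have "- p (- x) \<le> q x" if "q \<in> C" for q x
    using sublinear_minus[OF sub[OF that]] le[OF that, of "- x"] by (smt (verit))
  then have bdd: "bdd_below ((\<lambda>q. q x) ` C)" for x by (auto intro!: bdd_belowI[of _ "- p (- x)"])
  show low: "(INF q\<in>C. q x) \<le> q x" if "q \<in> C" for q x
    using bdd that by (rule cINF_lower)
  show "sublinear (\<lambda>x. INF q\<in>C. q x)"
    unfolding sublinear_def
  proof (intro conjI allI impI)
    fix x y
    have *: "(INF q\<in>C. q (x + y)) \<le> q x + r y" if "q \<in> C" "r \<in> C" for q r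
    proof -
      obtain s where s: "s \<in> C" "s \<le> q" "s \<le> r" using chain \<open>q \<in> C\<close> \<open>r \<in> C\<close> by blast
      have "(INF q\<in>C. q (x + y)) \<le> s (x + y)" by (rule low[OF s(1)])
      also have "\<dots> \<le> s x + s y" by (rule sublinear_add[OF sub[OF s(1)]])
      also have "\<dots> \<le> q x + r y" using s by (intro add_mono) (auto simp: le_fun_def)
      finally show ?thesis .
    qed
    have "(INF q\<in>C. q (x + y)) - q x \<le> (INF r\<in>C. r y)" if "q \<in> C" for q
      by (rule cINF_greatest[OF assms(1)]) (use *[OF that] in \<open>simp add: algebra_simps\<close>)
    then have "(INF q\<in>C. q (x + y)) - (INF r\<in>C. r y) \<le> (INF q\<in>C. q x)"
      by (intro cINF_greatest[OF assms(1)]) (simp add: algebra_simps)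
    then show "(INF q\<in>C. q (x + y)) \<le> (INF q\<in>C. q x) + (INF q\<in>C. q y)" by simp
  next
    fix t :: real and x assume t: "t > 0"
    have "(INF q\<in>C. q (t *\<^sub>R x)) / t \<le> (INF q\<in>C. q x)"
    proof (rule cINF_greatest[OF assms(1)])
      fix q assume q: "q \<in> C"
      show "(INF q\<in>C. q (t *\<^sub>R x)) / t \<le> q x"
        using low[OF q, of "t *\<^sub>R x"] sublinear_scaleR[OF sub[OF q], of t x] t by (simp add: field_simps)
    qed
    then show "(INF q\<in>C. q (t *\<^sub>R x)) \<le> t * (INF q\<in>C. q x)" using t by (simp add: field_simps)
  qed
qed

text \<open>Zorn's lemma for the reversed pointwise order; the bound of a nonempty chain is its
  pointwise infimum.\<close>

lemma minimal_sublinear: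
  fixes p :: "'v::real_vector \<Rightarrow> real"
  assumes "sublinear p"
  obtains q where "sublinear q" "q \<le> p" "\<And>r. sublinear r \<Longrightarrow> r \<le> q \<Longrightarrow> r = q"
proof -
  define A where "A = {q. sublinear q \<and> q \<le> p}"
  let ?R = "relation_of (\<lambda>a b. b \<le> a) A"
  have "\<exists>m\<in>A. \<forall>a\<in>A. a \<le> m \<longrightarrow> a = m"
  proof (rule predicate_Zorn)
    show "partial_order_on A ?R"
      by (auto simp: partial_order_on_def preorder_on_def refl_on_def trans_def antisym_def relation_of_def)
    fix C assume C: "C \<in> Chains ?R"
    then have CA: "C \<subseteq> A" and ch: "\<And>q r. q \<in> C \<Longrightarrow> r \<in> C \<Longrightarrow> q \<le> r \<or> r \<le> q"
      by (auto simp: Chains_def relation_of_def)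
    show "\<exists>u\<in>A. \<forall>a\<in>C. u \<le> a"
    proof (cases "C = {}")
      case True
      then show ?thesis using assms by (auto simp: A_def)
    next
      case False
      let ?u = "\<lambda>x. INF q\<in>C. q x"
      have sub: "sublinear ?u" and low: "\<And>q x. q \<in> C \<Longrightarrow> ?u x \<le> q x"
        by (rule sublinear_INF_chain[OF False, where p = p]; use CA ch in \<open>auto simp: A_def le_fun_def\<close>)+
      obtain q where q: "q \<in> C" using False by blast
      have "?u \<le> p" using low[OF q] q CA unfolding A_def le_fun_def by (blast intro: order_trans)
      then show ?thesis using sub low by (auto simp: A_def le_fun_def intro!: bexI[of _ ?u])
    qed
  qed
  then obtain m where m: "m \<in> A" "\<And>a. a \<in> A \<Longrightarrow> a \<le> m \<Longrightarrow> a = m" by blast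
  show ?thesis
    by (rule that[of m]) (use m in \<open>auto simp: A_def\<close>)
qed

text \<open>A minimal sublinear function below \<open>p\<close> is already linear: lowering it along
  the ray through \<open>y\<close> cannot change it, which yields superadditivity.\<close>

lemma sublinear_dominates_linear:
  fixes p :: "'v::real_vector \<Rightarrow> real"
  assumes "sublinear p"
  obtains F where "linear F" "\<And>x. F x \<le> p x"
proof -
  obtain q where q: "sublinear q" "q \<le> p" and min: "\<And>r. sublinear r \<Longrightarrow> r \<le> q \<Longrightarrow> r = q"
    using minimal_sublinear[OF assms] by blast
  have add: "q (x + y) = q x + q y" for x y
  proof -
    let ?W = "(\<lambda>t. (t *\<^sub>R y, t * q y)) ` {0..}"
    obtain r where r: "sublinear r" and rle: "\<And>x w c. (w, c) \<in> ?W \<Longrightarrow> r x \<le> q (x + w) - c"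
    proof (rule sublinear_lower_cone[OF q(1), of ?W])
      show "u + v \<in> ?W" if uv: "u \<in> ?W" "v \<in> ?W" for u v
      proof -
        obtain s t where st: "u = (s *\<^sub>R y, s * q y)" "v = (t *\<^sub>R y, t * q y)" "s \<ge> 0" "t \<ge> 0"
          using uv by auto
        show ?thesis by (rule image_eqI[of _ _ "s + t"]) (use st in \<open>auto simp: algebra_simps\<close>)
      qed
      show "s *\<^sub>R u \<in> ?W" if s: "s > 0" and u: "u \<in> ?W" for s u
      proof -
        obtain t where t: "u = (t *\<^sub>R y, t * q y)" "t \<ge> 0" using u by auto
        show ?thesis by (rule image_eqI[of _ _ "s * t"]) (use s t in auto)
      qed
      show "c \<le> q w" if "(w, c) \<in> ?W" for w c
        using that sublinear_scaleR[OF q(1)] by auto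
    qed auto
    have "r x \<le> q x" for x using rle[of 0 0 x] by (auto simp: image_iff)
    then have "r = q" using min r by (auto simp: le_fun_def)
    \<comment> \<open>The point at \<open>t = 1\<close> turns the bound on \<open>r = q\<close> into
      \<open>q x + q y \<le> q (x + y)\<close>.\<close>
    moreover have "(y, q y) \<in> ?W" by (rule image_eqI[of _ _ 1]) auto
    ultimately have "q x \<le> q (x + y) - q y" using rle by blast
    then show ?thesis using sublinear_add[OF q(1), of x y] by simp
  qed
  have neg: "q (- x) = - q x" for x
    using add[of x "- x"] sublinear_0[OF q(1)] by simp
  have "q (t *\<^sub>R x) = t * q x" for t x
  proof (cases "t \<ge> 0")
    case False
    then have "q ((- t) *\<^sub>R x) = (- t) * q x" by (intro sublinear_scaleR[OF q(1)]) simp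
    then show ?thesis using neg[of "t *\<^sub>R x"] by simp
  qed (rule sublinear_scaleR[OF q(1)])
  then have "linear q" using add by (intro linearI) auto
  then show ?thesis using that q(2) by (auto simp: le_fun_def)
qed

text \<open>The functional to be extended is given by its graph \<open>W\<close>; that \<open>W\<close> is single-valued
  follows from the domination by \<open>p\<close>.\<close>

theorem hahn_banach:
  fixes p :: "'v::real_vector \<Rightarrow> real" and W :: "('v \<times> real) set"
  assumes p: "sublinear p" and W: "subspace W" and le: "\<And>w c. (w, c) \<in> W \<Longrightarrow> c \<le> p w"
  obtains F where "linear F" "\<And>x. F x \<le> p x" "\<And>w c. (w, c) \<in> W \<Longrightarrow> F w = c"
proof -
  obtain q where q: "sublinear q" and qle: "\<And>x w c. (w, c) \<in> W \<Longrightarrow> q x \<le> p (x + w) - c"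
    by (rule sublinear_lower_cone[OF p _ _ _ le, of W])
      (use W in \<open>auto simp: subspace_0 subspace_add subspace_scale dest: subspace_0\<close>)
  obtain F where F: "linear F" "\<And>x. F x \<le> q x"
    using sublinear_dominates_linear[OF q] by blast
  \<comment> \<open>Shifting \<open>- w\<close> by \<open>w\<close> gives
    \<open>F (- w) \<le> p 0 - c\<close>. The reverse inequality comes from the graph point
    \<open>(- w, - c)\<close>.\<close>
  have ge: "c \<le> F w" if "(w, c) \<in> W" for w c
    using F(2)[of "- w"] qle[OF that, of "- w"] by (simp add: linear_neg[OF F(1)] sublinear_0[OF p])
  show ?thesis
  proof (rule that[OF F(1)])
    show "F x \<le> p x" for x
      using F(2)[of x] qle[of 0 0 x] subspace_0[OF W] by (simp add: zero_prod_def)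
    show "F w = c" if "(w, c) \<in> W" for w c
      using ge[OF that] ge[of "- w" "- c"] subspace_neg[OF W that] by (simp add: linear_neg[OF F(1)])
  qed
qed

section \<open>Real and complex scalars\<close>

text \<open>\<open>\<rho>\<close> is the real part and \<open>J\<close> the imaginary unit; over \<open>\<real>\<close>, taking \<open>J = 0\<close> makes the complex
  formulas below valid as they stand.\<close>

definition scalar_parts :: "('k::real_or_complex \<Rightarrow> real) \<Rightarrow> 'k \<Rightarrow> bool" where
  "scalar_parts \<rho> J \<longleftrightarrow> linear \<rho> \<and> (\<forall>z. \<bar>\<rho> z\<bar> \<le> norm z) \<and>
     (\<forall>z. z = of_real (\<rho> z) - J * of_real (\<rho> (J * z))) \<and>
     (\<forall>a. \<rho> (of_real a) = a) \<and> (\<forall>a. \<rho> (J * of_real a) = 0) \<and> (J = 0 \<or> J * J = - 1)"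

lemma scalar_parts_exist: "\<exists>(\<rho> :: 'k::real_or_complex \<Rightarrow> real) J. scalar_parts \<rho> J"
  using real_or_complex[where 'a = 'k]
proof
  assume "range (\<lambda>r::real. r *\<^sub>R 1) = (UNIV :: 'k set)"
  then have "\<forall>z::'k. \<exists>r. z = of_real r" by (metis (mono_tags) UNIV_I image_iff of_real_def)
  then obtain \<rho> where \<rho>: "\<And>z::'k. z = of_real (\<rho> z)" by metis
  have inv: "\<rho> (of_real a) = a" for a using \<rho>[of "of_real a"] of_real_eq_iff by metis
  have "linear \<rho>"
  proof
    show "\<rho> (x + y) = \<rho> x + \<rho> y" for x y
      by (metis \<rho> inv of_real_add)
    show "\<rho> (r *\<^sub>R x) = r *\<^sub>R \<rho> x" for r x
      by (metis \<rho> inv of_real_mult real_scaleR_def scaleR_conv_of_real)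
  qed
  moreover have "\<bar>\<rho> z\<bar> \<le> norm z" for z using norm_of_real[of "\<rho> z", where 'a = 'k] \<rho>[of z] by simp
  moreover have "\<rho> 0 = 0" using inv[of 0] by simp
  ultimately have "scalar_parts \<rho> 0" using \<rho>[symmetric] inv by (simp add: scalar_parts_def)
  then show ?thesis by blast
next
  assume "\<exists>\<phi>::complex \<Rightarrow> 'k. bij \<phi> \<and> (\<forall>z w. \<phi> (z + w) = \<phi> z + \<phi> w) \<and>
        (\<forall>z w. \<phi> (z * w) = \<phi> z * \<phi> w) \<and> (\<forall>r. \<phi> (of_real r) = r *\<^sub>R 1) \<and>
        (\<forall>z. norm (\<phi> z) = norm z)"
  then obtain \<phi> :: "complex \<Rightarrow> 'k" where \<phi>: "bij \<phi>" "\<And>z w. \<phi> (z + w) = \<phi> z + \<phi> w"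
    "\<And>z w. \<phi> (z * w) = \<phi> z * \<phi> w" "\<And>r. \<phi> (of_real r) = of_real r" "\<And>z. norm (\<phi> z) = norm z"
    by (auto simp: of_real_def)
  define \<psi> where "\<psi> = inv \<phi>"
  have \<psi>\<phi>: "\<psi> (\<phi> z) = z" for z using \<phi>(1) by (simp add: \<psi>_def bij_is_inj)
  have \<phi>\<psi>: "\<phi> (\<psi> z) = z" for z using \<phi>(1) by (simp add: \<psi>_def bij_is_surj surj_f_inv_f)
  have \<psi>_add: "\<psi> (x + y) = \<psi> x + \<psi> y" for x y by (metis \<phi>(2) \<phi>\<psi> \<psi>\<phi>)
  have \<psi>_mult: "\<psi> (x * y) = \<psi> x * \<psi> y" for x y by (metis \<phi>(3) \<phi>\<psi> \<psi>\<phi>)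
  have \<psi>_real: "\<psi> (of_real r) = of_real r" for r by (metis \<phi>(4) \<psi>\<phi>)
  define \<rho> where "\<rho> = (\<lambda>z. Re (\<psi> z))"
  define J where "J = \<phi> \<i>"
  have \<psi>J: "\<psi> J = \<i>" by (simp add: J_def \<psi>\<phi>)
  have "linear \<rho>"
    by (rule linearI) (simp_all add: \<rho>_def \<psi>_add \<psi>_mult \<psi>_real scaleR_conv_of_real)
  moreover have "\<bar>\<rho> z\<bar> \<le> norm z" for z
    using abs_Re_le_cmod[of "\<psi> z"] \<phi>(5)[of "\<psi> z"] by (simp add: \<rho>_def \<phi>\<psi>)
  moreover have "z = of_real (\<rho> z) - J * of_real (\<rho> (J * z))" for z
  proof -
    \<comment> \<open>The real part of \<open>\<i> * z\<close> is minus the imaginary part of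
      \<open>z\<close>. The sign is written as \<open>of_real (- 1)\<close> because
      \<open>\<phi>\<close> is known to preserve only sums, products, real scalars and
      norms.\<close>
    have "\<psi> z = of_real (\<rho> z) + of_real (- 1) * (\<i> * of_real (\<rho> (J * z)))"
      by (simp add: \<rho>_def \<psi>_mult \<psi>J complex_eq_iff)
    from arg_cong[OF this, of \<phi>]
    have "z = of_real (\<rho> z) + of_real (- 1) * (J * of_real (\<rho> (J * z)))"
      by (simp only: \<phi>(2,3,4) J_def \<phi>\<psi>)
    then show ?thesis by simp
  qed
  moreover have "\<rho> (of_real a) = a" "\<rho> (J * of_real a) = 0" for a
    by (simp_all add: \<rho>_def \<psi>_mult \<psi>J \<psi>_real)
  moreover have "J * J = - 1"
  proof -
    have "J * J = \<phi> (of_real (- 1))" by (simp add: J_def flip: \<phi>(3))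
    then show ?thesis by (simp only: \<phi>(4)) simp
  qed
  ultimately have "scalar_parts \<rho> J" by (simp add: scalar_parts_def)
  then show ?thesis by blast
qed

text \<open>The real part and a matching imaginary unit are fixed once per scalar type, so that one
  formula serves both fields.\<close>

definition re_part :: "'k::real_or_complex \<Rightarrow> real" where
  "re_part = (SOME \<rho>. \<exists>J. scalar_parts \<rho> J)"

definition im_unit :: "'k::real_or_complex" where
  "im_unit = (SOME J. scalar_parts re_part J)"

lemma scalar_parts: "scalar_parts (re_part :: 'k::real_or_complex \<Rightarrow> real) im_unit"
proof -
  have "\<exists>J :: 'k. scalar_parts re_part J"
    unfolding re_part_def using someI_ex[OF scalar_parts_exist] .
  then show ?thesis unfolding im_unit_def by (rule someI_ex)
qed

lemma
  fixes z :: "'k::real_or_complex"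
  shows linear_re_part: "linear (re_part :: 'k \<Rightarrow> real)"
    and abs_re_part_le: "\<bar>re_part z\<bar> \<le> norm z"
    and re_part_of_real [simp]: "re_part (of_real a :: 'k) = a"
    and re_part_im_unit_mult [simp]: "re_part (im_unit * of_real a :: 'k) = 0"
    and im_unit_cases: "im_unit = (0 :: 'k) \<or> im_unit * im_unit = (- 1 :: 'k)"
  using scalar_parts[where 'k = 'k] unfolding scalar_parts_def by blast+

lemma scalar_decomp: "z = of_real (re_part z) - im_unit * of_real (re_part (im_unit * z))"
  using scalar_parts unfolding scalar_parts_def by blast

text \<open>No norm is involved, so the Hahn-Banach results below apply both to the Banach space and
  to the space of bounded functionals on it, where a different seminorm is used.\<close>

locale real_or_complex_space =
  fixes sc :: "'k::real_or_complex \<Rightarrow> 'v::real_vector \<Rightarrow> 'v"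
  assumes sc_add_right: "sc c (x + y) = sc c x + sc c y"
    and sc_add_left: "sc (c + d) x = sc c x + sc d x"
    and sc_sc: "sc c (sc d x) = sc (c * d) x"
    and sc_of_real: "sc (of_real r) x = r *\<^sub>R x"
begin

lemma sc_0_left [simp]: "sc 0 x = 0" and sc_1 [simp]: "sc 1 x = x" and sc_minus_1: "sc (- 1) x = - x"
  using sc_of_real[of 0 x] sc_of_real[of 1 x] sc_of_real[of "- 1" x] by simp_all

lemma sc_scaleR: "sc c (r *\<^sub>R x) = r *\<^sub>R sc c x"
  by (simp add: sc_sc mult.commute flip: sc_of_real)

lemma sc_minus_right: "sc c (- x) = - sc c x"
  using sc_scaleR[of c "- 1" x] by simp

lemma sc_0_right [simp]: "sc c 0 = 0"
  using sc_scaleR[of c 0 0] by simp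

lemma sc_diff_right: "sc c (x - y) = sc c x - sc c y"
  using sc_add_right[of c x "- y"] by (simp add: sc_minus_right)

lemma sc_decomp: "sc c x = re_part c *\<^sub>R x - re_part (im_unit * c) *\<^sub>R sc im_unit x"
proof -
  have "sc c x = sc (of_real (re_part c) + of_real (- re_part (im_unit * c)) * im_unit) x"
    using scalar_decomp[of c] by (simp add: mult.commute)
  also have "\<dots> = sc (of_real (re_part c)) x + sc (of_real (- re_part (im_unit * c))) (sc im_unit x)"
    by (simp only: sc_add_left sc_sc)
  finally show ?thesis by (simp only: sc_of_real) simp
qed

lemma sc_im_unit_twice: "sc im_unit (sc im_unit x) = (if im_unit = (0::'k) then 0 else - x)"
  using im_unit_cases[where 'k = 'k] by (auto simp: sc_sc sc_minus_1)

definition seminorm_over :: "('v \<Rightarrow> real) \<Rightarrow> bool" where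
  "seminorm_over p \<longleftrightarrow> (\<forall>x y. p (x + y) \<le> p x + p y) \<and> (\<forall>c x. p (sc c x) = norm c * p x)"

definition functional :: "('v \<Rightarrow> 'k) \<Rightarrow> bool" where
  "functional \<phi> \<longleftrightarrow> (\<forall>x y. \<phi> (x + y) = \<phi> x + \<phi> y) \<and> (\<forall>c x. \<phi> (sc c x) = c * \<phi> x)"

lemma seminorm_sublinear: "seminorm_over p \<Longrightarrow> sublinear p"
  unfolding seminorm_over_def sublinear_def by (metis order.refl norm_of_real real_norm_def abs_of_pos sc_of_real)

lemma seminorm_nonneg: assumes "seminorm_over p" shows "0 \<le> p x"
proof -
  have "p (sc (- 1) x) = norm (- 1 :: 'k) * p x" using assms by (simp only: seminorm_over_def)
  then have "p (- x) = p x" by (simp add: sc_minus_1)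
  then show ?thesis using sublinear_minus[OF seminorm_sublinear[OF assms], of x] by simp
qed

text \<open>The classical passage from a real functional \<open>F\<close> to
  \<open>F(x) - i F(ix)\<close>; with \<open>im_unit = 0\<close> it returns \<open>F\<close>
  itself.\<close>

lemma complexify:
  assumes F: "linear F" "\<And>x. F x \<le> p x" and p: "seminorm_over p"
  defines "\<phi> \<equiv> \<lambda>x. of_real (F x) - im_unit * of_real (F (sc im_unit x))"
  shows "functional \<phi>" "norm (\<phi> x) \<le> p x" "re_part (\<phi> x) = F x"
proof -
  note lin = linear_add[OF F(1)] linear_diff[OF F(1)] linear_scale[OF F(1)] linear_0[OF F(1)]
    linear_neg[OF F(1)]
  \<comment> \<open>Together with real linearity, compatibility with \<open>im_unit\<close> gives
    homogeneity for every scalar through \<open>sc_decomp\<close>.\<close>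
  have im: "\<phi> (sc im_unit x) = im_unit * \<phi> x" for x
    using im_unit_cases[where 'k = 'k]
  proof
    assume "im_unit * im_unit = (- 1 :: 'k)"
    then have "im_unit * (im_unit * z) = - z" for z :: 'k by (simp flip: mult.assoc)
    then show ?thesis by (auto simp: \<phi>_def sc_im_unit_twice lin right_diff_distrib)
  qed (simp add: \<phi>_def lin)
  have diff: "\<phi> (x - y) = \<phi> x - \<phi> y" and add: "\<phi> (x + y) = \<phi> x + \<phi> y"
    and scal: "\<phi> (r *\<^sub>R x) = of_real r * \<phi> x" for r x y
    by (simp_all add: \<phi>_def lin sc_add_right sc_diff_right sc_scaleR algebra_simps)
  have sc: "\<phi> (sc c x) = c * \<phi> x" for c x
  proof -
    have "\<phi> (sc c x) = (of_real (re_part c) - im_unit * of_real (re_part (im_unit * c))) * \<phi> x"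
      unfolding sc_decomp[of c x] diff scal im by (simp add: algebra_simps)
    then show ?thesis by (simp only: scalar_decomp[of c, symmetric])
  qed
  show "functional \<phi>" using add sc by (simp add: functional_def)
  show re: "re_part (\<phi> x) = F x" for x
    by (simp add: \<phi>_def linear_diff[OF linear_re_part])
  show "norm (\<phi> x) \<le> p x"
  proof (cases "\<phi> x = 0")
    case True
    then show ?thesis using seminorm_nonneg[OF p] by simp
  next
    case False
    \<comment> \<open>A scalar of modulus one that rotates \<open>\<phi> x\<close> to its absolute
      value; there \<open>\<phi>\<close> has the real value \<open>F (sc c x)\<close>.\<close>
    define c where "c = of_real (norm (\<phi> x)) / \<phi> x"
    have "\<phi> (sc c x) = of_real (norm (\<phi> x))" using False by (simp add: sc c_def)
    then have "norm (\<phi> x) = F (sc c x)" using re[of "sc c x"] by simp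
    also have "\<dots> \<le> p (sc c x)" by (rule F(2))
    also have "\<dots> = p x" using p False by (simp add: seminorm_over_def c_def norm_divide)
    finally show ?thesis .
  qed
qed

text \<open>Hahn-Banach is applied to the real functional that vanishes on \<open>W\<close> and
  takes the value \<open>\<delta>\<close> at \<open>v\<close>. Stability of \<open>W\<close> under
  \<open>im_unit\<close> ensures that the complexified functional also vanishes on
  \<open>W\<close>.\<close>

lemma separation:
  assumes p: "seminorm_over p" and W: "subspace W" "\<And>x. x \<in> W \<Longrightarrow> sc im_unit x \<in> W"
    and \<delta>: "\<delta> \<ge> 0" "\<And>w. w \<in> W \<Longrightarrow> \<delta> \<le> p (v - w)"
  obtains \<phi> where "functional \<phi>" "\<And>x. norm (\<phi> x) \<le> p x" "\<And>w. w \<in> W \<Longrightarrow> \<phi> w = 0" "\<delta> \<le> norm (\<phi> v)"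
proof -
  define V where "V = {(w + t *\<^sub>R v, t * \<delta>) | w t. w \<in> W}"
  have VI: "(w + t *\<^sub>R v, t * \<delta>) \<in> V" if "w \<in> W" for w t using that by (auto simp: V_def)
  have sub: "subspace V"
  proof (rule subspaceI)
    show "0 \<in> V" using VI[OF subspace_0[OF W(1)], of 0] by (simp add: zero_prod_def)
    fix a b assume "a \<in> V" "b \<in> V"
    then obtain w t w' t' where wt: "w \<in> W" "w' \<in> W" "a = (w + t *\<^sub>R v, t * \<delta>)" "b = (w' + t' *\<^sub>R v, t' * \<delta>)"
      by (auto simp: V_def)
    show "a + b \<in> V" using VI[OF subspace_add[OF W(1) wt(1,2)], of "t + t'"] by (simp add: wt algebra_simps)
  next
    fix r a assume "a \<in> V"
    then obtain w t where wt: "w \<in> W" "a = (w + t *\<^sub>R v, t * \<delta>)" by (auto simp: V_def)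
    show "r *\<^sub>R a \<in> V" using VI[OF subspace_scale[OF W(1) wt(1)], of r "r * t"] by (simp add: wt algebra_simps)
  qed
  have le: "c \<le> p x" if xc: "(x, c) \<in> V" for x c
  proof -
    obtain w t where wt: "w \<in> W" "x = w + t *\<^sub>R v" "c = t * \<delta>" using xc by (auto simp: V_def)
    show ?thesis
    \<comment> \<open>For \<open>t > 0\<close>, dividing by \<open>t\<close> reduces the claim to
      the distance bound for \<open>v\<close>. Otherwise \<open>t * \<delta> \<le> 0\<close>, and
      nonnegativity of \<open>p\<close> suffices.\<close>
    proof (cases "t > 0")
      case True
      have "\<delta> \<le> p (v - (- inverse t) *\<^sub>R w)" using \<delta>(2) subspace_scale[OF W(1) wt(1)] by blast
      then have "t * \<delta> \<le> t * p (v - (- inverse t) *\<^sub>R w)" using True by simp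
      also have "\<dots> = p (t *\<^sub>R (v - (- inverse t) *\<^sub>R w))"
        using sublinear_scaleR[OF seminorm_sublinear[OF p]] True by simp
      also have "t *\<^sub>R (v - (- inverse t) *\<^sub>R w) = x" using True by (simp add: wt algebra_simps)
      finally show ?thesis by (simp add: wt)
    next
      case False
      then have "t * \<delta> \<le> 0" using \<delta>(1) by (simp add: mult_nonpos_nonneg)
      then show ?thesis using seminorm_nonneg[OF p, of x] wt by simp
    qed
  qed
  obtain F where F: "linear F" "\<And>x. F x \<le> p x" "\<And>x c. (x, c) \<in> V \<Longrightarrow> F x = c"
    using hahn_banach[OF seminorm_sublinear[OF p] sub le] by blast
  have F0: "F w = 0" if "w \<in> W" for w using F(3)[OF VI[OF that, of 0]] by simp
  have Fv: "F v = \<delta>" using F(3)[OF VI[OF subspace_0[OF W(1)], of 1]] by simp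
  show ?thesis
  proof (rule that[OF complexify(1)[OF F(1,2) p] complexify(2)[OF F(1,2) p]])
    show "of_real (F w) - im_unit * of_real (F (sc im_unit w)) = (0 :: 'k)" if "w \<in> W" for w
      using F0 W(2) that by simp
    show "\<delta> \<le> norm (of_real (F v) - im_unit * of_real (F (sc im_unit v)) :: 'k)"
      using abs_re_part_le[of "of_real (F v) - im_unit * of_real (F (sc im_unit v)) :: 'k"]
      unfolding complexify(3)[OF F(1,2) p] by (simp add: Fv abs_of_nonneg[OF \<delta>(1)])
  qed
qed

end

section \<open>The dual of a real or complex Banach space\<close>

text \<open>A substitute for subspaces that can be countable, so that almost-everywhere statements
  about all its elements can be combined.\<close>

definition rational_subspace :: "'v::real_vector set \<Rightarrow> bool" where
  "rational_subspace A \<longleftrightarrow>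
     0 \<in> A \<and> (\<forall>x\<in>A. \<forall>y\<in>A. x + y \<in> A) \<and> (\<forall>q\<in>\<rat>. \<forall>x\<in>A. q *\<^sub>R x \<in> A)"

text \<open>The closure under the operations is the increasing union of countably many enlargement
  steps, each preserving countability. The extra operation \<open>j\<close> will be multiplication
  by \<open>im_unit\<close>.\<close>

lemma countable_rational_subspace:
  assumes "countable A0" "A0 \<subseteq> C" "subspace C" "\<And>x. x \<in> C \<Longrightarrow> j x \<in> C"
  shows "\<exists>A. countable A \<and> A0 \<subseteq> A \<and> A \<subseteq> C \<and> rational_subspace A \<and> (\<forall>x\<in>A. j x \<in> A)"
proof -
  define step where "step = (\<lambda>A. A \<union> (\<lambda>(x, y). x + y) ` (A \<times> A) \<union> (\<lambda>(q, x). q *\<^sub>R x) ` (\<rat> \<times> A) \<union> j ` A)"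
  define B where "B = (\<lambda>n. (step ^^ n) (insert 0 A0))"
  have B: "B 0 = insert 0 A0" "B (Suc n) = step (B n)" for n by (simp_all add: B_def)
  have cnt: "countable (B n)" for n
    by (induction n) (use assms(1) in \<open>auto simp: B step_def countable_rat\<close>)
  have sub: "B n \<subseteq> C" for n
  proof (induction n)
    case 0
    then show ?case using assms subspace_0 by (auto simp: B)
  next
    case (Suc n)
    then show ?case
      by (auto simp: B step_def intro!: assms(4) subspace_add[OF assms(3)] subspace_scale[OF assms(3)])
  qed
  have "B n \<subseteq> B (Suc n)" for n by (auto simp: B step_def)
  then have mono: "B m \<subseteq> B n" if "m \<le> n" for m n using that by (rule lift_Suc_mono_le)
  show ?thesis
  proof (intro exI[of _ "\<Union>n. B n"] conjI ballI)
    show "countable (\<Union>n. B n)" using cnt by auto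
    show "A0 \<subseteq> (\<Union>n. B n)" using B(1) by blast
    show "(\<Union>n. B n) \<subseteq> C" using sub by blast
    show "j x \<in> (\<Union>n. B n)" if x: "x \<in> (\<Union>n. B n)" for x
    proof -
      obtain n where "x \<in> B n" using x by blast
      then have "j x \<in> B (Suc n)" by (auto simp: B step_def)
      then show ?thesis by blast
    qed
    show "rational_subspace (\<Union>n. B n)"
      unfolding rational_subspace_def
    proof (intro conjI ballI)
      show "0 \<in> (\<Union>n. B n)" using B(1) by blast
      fix x y assume "x \<in> (\<Union>n. B n)" "y \<in> (\<Union>n. B n)"
      then obtain m n where "x \<in> B m" "y \<in> B n" by blast
      \<comment> \<open>The stages increase, so two elements can be added once both have
        appeared.\<close>
      then have "x \<in> B (max m n)" "y \<in> B (max m n)" using mono[of m "max m n"] mono[of n "max m n"] by auto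
      then have "x + y \<in> B (Suc (max m n))" by (force simp: B step_def)
      then show "x + y \<in> (\<Union>n. B n)" by blast
    next
      fix q :: real and x assume q: "q \<in> \<rat>" and "x \<in> (\<Union>n. B n)"
      then obtain n where "x \<in> B n" by blast
      then have "q *\<^sub>R x \<in> B (Suc n)" using q by (force simp: B step_def)
      then show "q *\<^sub>R x \<in> (\<Union>n. B n)" by blast
    qed
  qed
qed

text \<open>Real multiples of points of \<open>A\<close> are limits of rational ones; continuity
  then extends this to the closure.\<close>

lemma subspace_closure_rational:
  fixes A :: "'v::real_normed_vector set"
  assumes A: "rational_subspace A"
  shows "subspace (closure A)"
proof (rule subspaceI)
  show "0 \<in> closure A" using A closure_subset by (auto simp: rational_subspace_def)
  show "x + y \<in> closure A" if xy: "x \<in> closure A" "y \<in> closure A" for x y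
  proof -
    obtain f g where "\<And>n. f n \<in> A" "f \<longlonglongrightarrow> x" "\<And>n. g n \<in> A" "g \<longlonglongrightarrow> y"
      using xy unfolding closure_sequential by metis
    then have "\<And>n. f n + g n \<in> A" "(\<lambda>n. f n + g n) \<longlonglongrightarrow> x + y"
      using A by (auto simp: rational_subspace_def intro: tendsto_add)
    then show ?thesis unfolding closure_sequential by (intro exI[of _ "\<lambda>n. f n + g n"]) auto
  qed
  show "c *\<^sub>R x \<in> closure A" if x: "x \<in> closure A" for c x
  proof -
    have "c *\<^sub>R y \<in> closure A" if y: "y \<in> A" for y
    proof -
      have "(\<lambda>q. q *\<^sub>R y) ` closure \<rat> \<subseteq> closure A"
        by (rule image_closure_subset)
          (use A y closure_subset[of A] in \<open>auto simp: rational_subspace_def intro!: continuous_intros\<close>)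
      then show ?thesis by (auto simp: Rats_closure_real)
    qed
    then have "(\<lambda>y. c *\<^sub>R y) ` closure A \<subseteq> closure A"
      by (intro image_closure_subset) (auto intro!: continuous_intros)
    then show ?thesis using x by blast
  qed
qed

locale normed_over = real_or_complex_space sc
  for sc :: "'k::real_or_complex \<Rightarrow> 'y::banach \<Rightarrow> 'y" +
  assumes norm_sc: "norm (sc c x) = norm c * norm x"
begin

definition dsc :: "'k \<Rightarrow> ('y \<Rightarrow>\<^sub>L 'k) \<Rightarrow> ('y \<Rightarrow>\<^sub>L 'k)" where
  "dsc c f = blinfun_mult_right c o\<^sub>L f"

lemma dsc_apply [simp]: "dsc c f y = c * f y"
  by (simp add: dsc_def)

lemma dual_space_over: "real_or_complex_space dsc"
  by standard (auto intro!: blinfun_eqI simp: blinfun.bilinear_simps algebra_simps scaleR_conv_of_real)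

sublocale dual: real_or_complex_space dsc
  by (rule dual_space_over)

text \<open>The type \<open>'y \<Rightarrow>\<^sub>L 'k\<close> records only real linearity. Taking
  the scalar-linear maps as a subset of it keeps its norm and topology at hand.\<close>

definition dual :: "('y \<Rightarrow>\<^sub>L 'k) set" where
  "dual = {f. \<forall>c y. blinfun_apply f (sc c y) = c * f y}"

lemma subspace_dual: "subspace dual"
  by (rule subspaceI) (auto simp: dual_def blinfun.bilinear_simps algebra_simps)

lemma dsc_dual: "f \<in> dual \<Longrightarrow> dsc c f \<in> dual"
  by (simp add: dual_def algebra_simps)

lemma dual_space_iff: "g \<in> dual_space sc \<longleftrightarrow> (\<exists>f\<in>dual. g = blinfun_apply f)"
  unfolding dual_space_def dual_def
  by (auto simp: blinfun.bounded_linear_right) (metis bounded_linear_Blinfun_apply)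

lemma norm_seminorm: "seminorm_over norm"
  by (simp add: seminorm_over_def norm_triangle_ineq norm_sc)

lemma functional_dual:
  assumes "functional \<phi>" "\<And>x. norm (\<phi> x) \<le> norm x"
  obtains f where "f \<in> dual" "blinfun_apply f = \<phi>"
proof -
  have "bounded_linear \<phi>"
    by (rule bounded_linear_intro[of _ 1])
      (use assms in \<open>auto simp: functional_def scaleR_conv_of_real simp flip: sc_of_real\<close>)
  then have "blinfun_apply (Blinfun \<phi>) = \<phi>" by (rule bounded_linear_Blinfun_apply)
  then show ?thesis using assms(1) by (intro that[of "Blinfun \<phi>"]) (simp_all add: dual_def functional_def)
qed

text \<open>Separation of \<open>y\<close> from the zero subspace, at distance
  \<open>norm y\<close>.\<close>

lemma norming_exists: "\<exists>f\<in>dual. (\<forall>x. norm (blinfun_apply f x) \<le> norm x) \<and> norm (f y) = norm y"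
proof -
  obtain \<phi> where \<phi>: "functional \<phi>" "\<And>x. norm (\<phi> x) \<le> norm x" "norm y \<le> norm (\<phi> y)"
    by (rule separation[OF norm_seminorm, of "{0}" "norm y" y]) auto
  obtain f where "f \<in> dual" "blinfun_apply f = \<phi>" using functional_dual[OF \<phi>(1,2)] by blast
  then show ?thesis using \<phi>(2,3) by (auto intro!: antisym)
qed

definition norming :: "'y \<Rightarrow> 'y \<Rightarrow>\<^sub>L 'k" where
  "norming y = (SOME f. f \<in> dual \<and> (\<forall>x. norm (blinfun_apply f x) \<le> norm x) \<and> norm (f y) = norm y)"

lemma norming: "norming y \<in> dual" "norm (norming y x) \<le> norm x" "norm (norming y y) = norm y"
  using someI_ex[OF norming_exists[of y, unfolded Bex_def]] unfolding norming_def by blast+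

text \<open>If \<open>d\<close> is close to \<open>y\<close>, then \<open>norming d\<close> is a
  contraction that nearly attains the norm at \<open>y\<close>. A countable dense set therefore
  gives countably many functionals that recover the norm.\<close>

lemma norm_le_norming:
  assumes y: "y \<in> closure D" and le: "\<And>d. d \<in> D \<Longrightarrow> norm (norming d y) \<le> t"
  shows "norm y \<le> t"
proof (rule field_le_epsilon)
  fix e :: real assume "e > 0"
  then obtain d where d: "d \<in> D" "dist d y < e / 2"
    using y unfolding closure_approachable by (meson half_gt_zero)
  have "norm y \<le> norm d + norm (y - d)" by (metis norm_triangle_sub)
  also have "norm d = norm (norming d y - norming d (y - d))"
    by (simp add: blinfun.bilinear_simps norming)
  also have "\<dots> \<le> t + norm (y - d)"
    using norm_triangle_ineq4[of "norming d y" "norming d (y - d)"] le[OF d(1)] norming(2)[of d "y - d"] by simp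
  also have "norm (y - d) = dist d y" by (simp add: dist_norm norm_minus_commute)
  finally show "norm y \<le> t + e" using d(2) by simp
qed

lemma separate_point:
  assumes W: "closed W" "subspace W" "\<And>x. x \<in> W \<Longrightarrow> sc im_unit x \<in> W" and v: "v \<notin> W"
  obtains f where "f \<in> dual" "\<And>w. w \<in> W \<Longrightarrow> blinfun_apply f w = 0" "f v \<noteq> 0"
proof -
  have ne: "W \<noteq> {}" using subspace_0[OF W(2)] by blast
  have pos: "infdist v W > 0" using W(1) v ne by (metis in_closed_iff_infdist_zero infdist_nonneg less_eq_real_def)
  have le: "infdist v W \<le> norm (v - w)" if "w \<in> W" for w using infdist_le[OF that, of v] by (simp add: dist_norm)
  obtain \<phi> where \<phi>: "functional \<phi>" "\<And>x. norm (\<phi> x) \<le> norm x" "\<And>w. w \<in> W \<Longrightarrow> \<phi> w = 0"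
      "infdist v W \<le> norm (\<phi> v)"
    by (rule separation[OF norm_seminorm W(2,3) infdist_nonneg le]) auto
  obtain f where "f \<in> dual" "blinfun_apply f = \<phi>" using functional_dual[OF \<phi>(1,2)] by blast
  then show ?thesis using \<phi>(3,4) pos that by fastforce
qed

text \<open>Transfers reflexivity from plain functions with \<open>onorm\<close> to bounded linear
  maps. Here \<open>\<phi>\<close> lives on all real-linear maps, as Hahn-Banach produces it, but it
  is represented only on \<open>dual\<close>.\<close>

lemma reflexiveD:
  assumes "reflexive_space sc" "dual.functional \<phi>" "\<And>f. norm (\<phi> f) \<le> C * norm f"
  obtains y where "\<And>f. f \<in> dual \<Longrightarrow> \<phi> f = blinfun_apply f y"
proof -
  have B: "Blinfun (blinfun_apply f) = f" for f :: "'y \<Rightarrow>\<^sub>L 'k" by (rule blinfun_apply_inverse)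
  have "(\<lambda>f. \<phi> (Blinfun f)) \<in> bidual_space sc"
    unfolding bidual_space_def
  proof (intro CollectI conjI ballI allI exI)
    fix f g assume "f \<in> dual_space sc" "g \<in> dual_space sc"
    then obtain f' g' where fg: "f = blinfun_apply f'" "g = blinfun_apply g'" using dual_space_iff by blast
    have "(\<lambda>y. f y + g y) = blinfun_apply (f' + g')" by (auto simp: fg blinfun.bilinear_simps)
    then show "\<phi> (Blinfun (\<lambda>y. f y + g y)) = \<phi> (Blinfun f) + \<phi> (Blinfun g)"
      using assms(2) by (simp add: fg B dual.functional_def)
  next
    fix c f assume "f \<in> dual_space sc"
    then obtain f' where f: "f = blinfun_apply f'" using dual_space_iff by blast
    have "(\<lambda>y. c * f y) = blinfun_apply (dsc c f')" by (auto simp: f)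
    then show "\<phi> (Blinfun (\<lambda>y. c * f y)) = c * \<phi> (Blinfun f)"
      using assms(2) by (simp add: f B dual.functional_def)
  next
    fix f assume "f \<in> dual_space sc"
    then obtain f' where f: "f = blinfun_apply f'" using dual_space_iff by blast
    show "norm (\<phi> (Blinfun f)) \<le> C * onorm f"
      using assms(3)[of f'] by (simp add: f B norm_blinfun.rep_eq)
  qed
  from assms(1)[unfolded reflexive_space_def, THEN bspec, OF this]
  obtain y where y: "\<forall>f\<in>dual_space sc. \<phi> (Blinfun f) = f y" by blast
  show ?thesis
  proof (rule that)
    show "\<phi> f = f y" if "f \<in> dual" for f using y that dual_space_iff B by metis
  qed
qed

section \<open>The seminorm on functionals given by the norm of their restriction to a
  subspace\<close>

definition dnorm :: "'y set \<Rightarrow> ('y \<Rightarrow>\<^sub>L 'k) \<Rightarrow> real" where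
  "dnorm Z f = (SUP y\<in>Z \<inter> cball 0 1. norm (f y))"

context
  fixes Z :: "'y set"
  assumes Z: "subspace Z"
begin

lemma zero_in_ball: "0 \<in> Z \<inter> cball 0 1"
  using subspace_0[OF Z] by simp

lemma dnorm_least: "(\<And>y. y \<in> Z \<Longrightarrow> norm y \<le> 1 \<Longrightarrow> norm (blinfun_apply f y) \<le> t) \<Longrightarrow> dnorm Z f \<le> t"
  unfolding dnorm_def by (rule cSUP_least) (use zero_in_ball in auto)

lemma dnorm_upper:
  assumes "y \<in> Z" "norm y \<le> 1" shows "norm (blinfun_apply f y) \<le> dnorm Z f"
  unfolding dnorm_def
proof (rule cSUP_upper)
  have "norm (blinfun_apply f y) \<le> norm f" if "norm y \<le> 1" for y
    using norm_blinfun[of f y] that by (meson mult_left_le norm_ge_zero order_trans)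
  then show "bdd_above ((\<lambda>y. norm (f y)) ` (Z \<inter> cball 0 1))" by (auto intro!: bdd_aboveI[of _ "norm f"])
qed (use assms in auto)

lemma dnorm_nonneg: "0 \<le> dnorm Z f"
  using dnorm_upper[of 0 f] subspace_0[OF Z] by simp

lemma apply_le_dnorm: "y \<in> Z \<Longrightarrow> norm (blinfun_apply f y) \<le> dnorm Z f * norm y"
  using dnorm_upper[of "inverse (norm y) *\<^sub>R y" f] subspace_scale[OF Z]
  by (cases "y = 0") (auto simp: blinfun.bilinear_simps field_simps)

lemma dnorm_le_norm: "dnorm Z f \<le> norm f"
  by (rule dnorm_least) (meson mult_left_le norm_blinfun norm_ge_zero order_trans)

lemma dnorm_seminorm: "dual.seminorm_over (dnorm Z)"
  unfolding dual.seminorm_over_def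
proof (intro conjI allI)
  show "dnorm Z (f + g) \<le> dnorm Z f + dnorm Z g" for f g
    by (rule dnorm_least)
      (auto simp: blinfun.bilinear_simps intro!: norm_triangle_mono dnorm_upper)
  have le: "dnorm Z (dsc c f) \<le> norm c * dnorm Z f" for c f
    by (rule dnorm_least) (auto simp: norm_mult intro!: mult_left_mono dnorm_upper)
  show "dnorm Z (dsc c f) = norm c * dnorm Z f" for c f
  proof (cases "c = 0")
    case False
    have "dnorm Z (dsc (inverse c) (dsc c f)) \<le> inverse (norm c) * dnorm Z (dsc c f)"
      using le[of "inverse c" "dsc c f"] by (simp add: norm_inverse)
    then have "norm c * dnorm Z f \<le> dnorm Z (dsc c f)"
      using False by (simp add: dual.sc_sc field_simps)
    then show ?thesis using le[of c f] by simp
  next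
    case True
    then show ?thesis using le[of c f] dnorm_nonneg[of "dsc c f"] by simp
  qed
qed

lemma dnorm_scaled_seminorm: "0 \<le> r \<Longrightarrow> dual.seminorm_over (\<lambda>f. r * dnorm Z f)"
  using dnorm_seminorm unfolding dual.seminorm_over_def
  by (auto simp: mult_left_mono simp flip: distrib_left)

lemma dnorm_triangle: "dnorm Z f \<le> dnorm Z g + norm (f - g)"
  using dnorm_seminorm dnorm_le_norm[of "f - g"] unfolding dual.seminorm_over_def
  by (metis add.commute diff_add_cancel add_right_mono order_trans)

lemma continuous_dnorm: "continuous_on UNIV (dnorm Z)"
proof -
  have "1-lipschitz_on UNIV (dnorm Z)"
  proof (rule lipschitz_onI)
    show "dist (dnorm Z f) (dnorm Z g) \<le> 1 * dist f g" for f g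
      using dnorm_triangle[of f g] dnorm_triangle[of g f] by (simp add: dist_norm norm_minus_commute abs_le_iff)
  qed simp
  then show ?thesis by (rule lipschitz_on_continuous_on)
qed

text \<open>Reflexivity provides \<open>y\<close> in the whole space. Were it outside
  \<open>Z\<close>, a functional vanishing on \<open>Z\<close> but not at \<open>y\<close> would
  have \<open>dnorm\<close> zero, contradicting the bound on \<open>\<phi>\<close>.\<close>

lemma reflexive_subspace:
  assumes "reflexive_space sc" "closed Z" "\<And>x. x \<in> Z \<Longrightarrow> sc im_unit x \<in> Z" "0 \<le> r"
    and \<phi>: "dual.functional \<phi>" "\<And>f. norm (\<phi> f) \<le> r * dnorm Z f"
  obtains y where "y \<in> Z" "\<And>f. f \<in> dual \<Longrightarrow> \<phi> f = blinfun_apply f y"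
proof -
  have "norm (\<phi> f) \<le> r * norm f" for f
    using \<phi>(2)[of f] dnorm_le_norm[of f] assms(4) by (meson mult_left_mono order_trans)
  then obtain y where y: "\<And>f. f \<in> dual \<Longrightarrow> \<phi> f = blinfun_apply f y" using reflexiveD[OF assms(1) \<phi>(1)] by blast
  have "y \<in> Z"
  proof (rule ccontr)
    assume "y \<notin> Z"
    then obtain f where f: "f \<in> dual" "\<And>w. w \<in> Z \<Longrightarrow> f w = 0" "f y \<noteq> 0"
      using separate_point[OF assms(2) Z assms(3)] by blast
    have "dnorm Z f \<le> 0" by (rule dnorm_least) (simp add: f)
    then have "r * dnorm Z f \<le> 0" using assms(4) by (simp add: mult_nonneg_nonpos)
    then show False using \<phi>(2)[of f] y[OF f(1)] f(3) by (metis norm_le_zero_iff order_trans)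
  qed
  then show ?thesis using that y by blast
qed

end

end

section \<open>Strong measurability and weak representation\<close>

text \<open>At stage \<open>n\<close>, \<open>u a\<close> is approximated by the first of the points
  \<open>d 0\<close>, ..., \<open>d n\<close> at minimal distance. Measurable distances make the
  chosen index measurable, it takes finitely many values, and \<open>u a \<in> closure D\<close>
  gives convergence.\<close>

lemma strongly_measurableI:
  fixes u :: "'a \<Rightarrow> 'y::banach"
  assumes D: "countable D" "D \<noteq> {}" and cl: "\<And>a. a \<in> space M \<Longrightarrow> u a \<in> closure D"
    and [measurable]: "\<And>d. d \<in> D \<Longrightarrow> (\<lambda>a. norm (u a - d)) \<in> borel_measurable M"
  shows "strongly_measurable M u"
proof -
  define d where "d = from_nat_into D"
  have dD: "d k \<in> D" for k using D(2) by (simp add: d_def from_nat_into)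
  have [measurable]: "(\<lambda>a. norm (u a - d k)) \<in> borel_measurable M" for k
    using assms(4) dD by blast
  define P where "P = (\<lambda>n a k. k \<le> n \<and> (\<forall>j\<in>{..n}. norm (u a - d k) \<le> norm (u a - d j)))"
  define K where "K = (\<lambda>n a. LEAST k. P n a k)"
  have P: "P n a (K n a)" for n a
  proof -
    obtain k where "k \<in> {..n}" "\<And>j. j \<in> {..n} \<Longrightarrow> norm (u a - d k) \<le> norm (u a - d j)"
      using ex_min_if_finite[of "(\<lambda>k. norm (u a - d k)) ` {..n}"] by (fastforce simp: not_less)
    then have "P n a k" by (auto simp: P_def)
    then show ?thesis unfolding K_def by (rule LeastI)
  qed
  have simple: "simple_function M (\<lambda>a. d (K n a))" for n
  proof -
    have "K n \<in> M \<rightarrow>\<^sub>M count_space UNIV" unfolding K_def P_def by measurable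
    moreover have "finite (K n ` space M)"
      by (rule finite_subset[of _ "{..n}"]) (use P in \<open>auto simp: P_def\<close>)
    ultimately have "simple_function M (K n)"
      unfolding simple_function_def by (auto intro: measurable_sets)
    from simple_function_compose[OF this, of d] show ?thesis by (simp add: comp_def)
  qed
  have "(\<lambda>n. d (K n a)) \<longlonglongrightarrow> u a" if a: "a \<in> space M" for a
  proof (rule LIMSEQ_I)
    fix e :: real assume "e > 0"
    then obtain k where k: "dist (d k) (u a) < e"
      using cl[OF a] from_nat_into_surj[OF D(1)] unfolding closure_approachable d_def by metis
    show "\<exists>m. \<forall>n\<ge>m. norm (d (K n a) - u a) < e"
    proof (intro exI[of _ k] allI impI)
      fix n assume "k \<le> n"
      then have "norm (u a - d (K n a)) \<le> norm (u a - d k)" using P[of n a] by (auto simp: P_def)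
      then show "norm (d (K n a) - u a) < e" using k by (simp add: dist_norm norm_minus_commute)
    qed
  qed
  then show ?thesis using simple unfolding strongly_measurable_def
    by (intro exI[of _ "\<lambda>n a. d (K n a)"]) auto
qed

lemma strongly_measurable_separable:
  assumes "strongly_measurable M u"
  obtains D where "countable D" "\<And>a. a \<in> space M \<Longrightarrow> u a \<in> closure D"
proof -
  obtain s where s: "\<And>n. simple_function M (s n)" "\<And>a. a \<in> space M \<Longrightarrow> (\<lambda>n. s n a) \<longlonglongrightarrow> u a"
    using assms unfolding strongly_measurable_def by blast
  show ?thesis
  proof (rule that[of "\<Union>n. s n ` space M"])
    show "countable (\<Union>n. s n ` space M)"
      using s(1) by (auto simp: simple_function_def countable_finite)
    show "u a \<in> closure (\<Union>n. s n ` space M)" if "a \<in> space M" for a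
      unfolding closure_sequential using s(2)[OF that] that by (intro exI[of _ "\<lambda>n. s n a"]) auto
  qed
qed

lemma strongly_measurable_borel:
  assumes "strongly_measurable M u"
  shows "u \<in> borel_measurable M"
proof -
  obtain s where s: "\<And>n. simple_function M (s n)" "\<And>a. a \<in> space M \<Longrightarrow> (\<lambda>n. s n a) \<longlonglongrightarrow> u a"
    using assms unfolding strongly_measurable_def by blast
  show ?thesis
    by (rule borel_measurable_LIMSEQ_metric[OF borel_measurable_simple_function[OF s(1)] s(2)])
qed

lemma strongly_measurable_continuous:
  assumes u: "strongly_measurable M u" and g: "continuous_on UNIV g"
  shows "strongly_measurable M (\<lambda>a. g (u a))"
proof -
  obtain s where s: "\<And>n. simple_function M (s n)" "\<And>a. a \<in> space M \<Longrightarrow> (\<lambda>n. s n a) \<longlonglongrightarrow> u a"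
    using u unfolding strongly_measurable_def by blast
  have "(\<lambda>n. g (s n a)) \<longlonglongrightarrow> g (u a)" if "a \<in> space M" for a
    by (rule continuous_on_tendsto_compose[OF g s(2)[OF that]]) auto
  then show ?thesis unfolding strongly_measurable_def
    using simple_function_compose1[OF s(1)] by (intro exI[of _ "\<lambda>n a. g (s n a)"]) auto
qed

lemma strongly_measurable_add:
  assumes "strongly_measurable M u" "strongly_measurable M v"
  shows "strongly_measurable M (\<lambda>a. u a + v a)"
proof -
  obtain s t where st: "\<And>n. simple_function M (s n)" "\<And>a. a \<in> space M \<Longrightarrow> (\<lambda>n. s n a) \<longlonglongrightarrow> u a"
    "\<And>n. simple_function M (t n)" "\<And>a. a \<in> space M \<Longrightarrow> (\<lambda>n. t n a) \<longlonglongrightarrow> v a"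
    using assms unfolding strongly_measurable_def by metis
  then show ?thesis unfolding strongly_measurable_def
    by (intro exI[of _ "\<lambda>n a. s n a + t n a"]) (auto intro!: simple_function_compose2 tendsto_add)
qed

section \<open>Countable families of functionals, reflexivity and weak representation\<close>

context normed_over
begin

lemma bounded_linear_sc: "bounded_linear (sc c)"
  by (rule bounded_linear_intro[of _ "norm c"])
    (auto simp: sc_add_right sc_scaleR norm_sc)

lemma closure_im_unit_closed:
  assumes "\<And>x. x \<in> A \<Longrightarrow> sc im_unit x \<in> A" "x \<in> closure A"
  shows "sc im_unit x \<in> closure A"
proof -
  have "sc im_unit ` closure A \<subseteq> closure A"
    by (rule image_closure_subset)
      (use assms(1) closure_subset[of A] in \<open>auto intro!: linear_continuous_on bounded_linear_sc\<close>)
  then show ?thesis using assms(2) by blast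
qed

lemma dual_closure_im_unit_closed:
  assumes "\<And>f. f \<in> A \<Longrightarrow> dsc im_unit f \<in> A" "f \<in> closure A"
  shows "dsc im_unit f \<in> closure A"
proof -
  have "continuous_on (closure A) (dsc im_unit)"
    unfolding dsc_def by (intro continuous_intros)
  then have "dsc im_unit ` closure A \<subseteq> closure A"
    by (rule image_closure_subset) (use assms(1) closure_subset[of A] in auto)
  then show ?thesis using assms(2) by blast
qed

text \<open>Otherwise a functional on the dual, bounded by \<open>dnorm\<close>, vanishes on
  \<open>H\<close> but not at \<open>f\<close>. By reflexivity it is evaluation at a point
  \<open>y\<close> of the closure of \<open>D\<close>; the norming functionals in \<open>H\<close>
  force \<open>y = 0\<close>, a contradiction.\<close>

lemma dnorm_dense:
  assumes refl: "reflexive_space sc"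
    and D: "rational_subspace D" "\<And>x. x \<in> D \<Longrightarrow> sc im_unit x \<in> D"
    and H: "rational_subspace H" "\<And>f. f \<in> H \<Longrightarrow> dsc im_unit f \<in> H" "H \<subseteq> dual" "norming ` D \<subseteq> H"
    and f: "f \<in> dual" and e: "0 < e"
  shows "\<exists>g\<in>H. dnorm (closure D) (f - g) < e"
proof (rule ccontr)
  let ?Z = "closure D"
  note Z = subspace_closure_rational[OF D(1)]
  assume "\<not> (\<exists>g\<in>H. dnorm ?Z (f - g) < e)"
  then have far: "e \<le> dnorm ?Z (f - g)" if "g \<in> H" for g using that by (meson not_le)
  \<comment> \<open>Separation needs a real subspace, so the distance is passed from
    \<open>H\<close> to its norm closure at the cost of half of \<open>e\<close>.\<close>
  have far': "e / 2 \<le> dnorm ?Z (f - w)" if w: "w \<in> closure H" for w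
  proof -
    obtain g where g: "g \<in> H" "dist g w < e / 2"
      using w e unfolding closure_approachable by (meson half_gt_zero)
    have "e \<le> dnorm ?Z (f - w) + norm ((f - g) - (f - w))"
      using far[OF g(1)] dnorm_triangle[OF Z, of "f - g" "f - w"] by simp
    then show ?thesis using g(2) by (simp add: dist_norm norm_minus_commute)
  qed
  obtain \<phi> where \<phi>: "dual.functional \<phi>" "\<And>h. norm (\<phi> h) \<le> dnorm ?Z h"
      "\<And>w. w \<in> closure H \<Longrightarrow> \<phi> w = 0" "e / 2 \<le> norm (\<phi> f)"
    by (rule dual.separation[OF dnorm_seminorm[OF Z] subspace_closure_rational[OF H(1)]
        dual_closure_im_unit_closed[OF H(2)] _ far']) (use e in auto)
  obtain y where y: "y \<in> ?Z" "\<And>h. h \<in> dual \<Longrightarrow> \<phi> h = blinfun_apply h y"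
    by (rule reflexive_subspace[OF Z refl _ closure_im_unit_closed[OF D(2)], of 1 \<phi>]) (use \<phi> in auto)
  have "norm y \<le> 0"
  proof (rule norm_le_norming[OF y(1)])
    fix d assume "d \<in> D"
    then have "norming d \<in> closure H" using H(4) closure_subset by blast
    then show "norm (norming d y) \<le> 0" using \<phi>(3) y(2) norming(1) by fastforce
  qed
  then show False using y(2)[OF f] \<phi>(4) e by simp
qed

text \<open>\<open>c\<close> is only rational-linear on \<open>H\<close>, so Hahn-Banach is applied
  to the closure of the graph of its real part. The complexified extension is then evaluation at a
  point of the closure of \<open>D\<close>.\<close>

lemma represent_functional:
  assumes refl: "reflexive_space sc"
    and D: "rational_subspace D" "\<And>x. x \<in> D \<Longrightarrow> sc im_unit x \<in> D"
    and H: "rational_subspace H" "\<And>f. f \<in> H \<Longrightarrow> dsc im_unit f \<in> H" "H \<subseteq> dual"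
    and c: "\<And>f g. f \<in> H \<Longrightarrow> g \<in> H \<Longrightarrow> c (f + g) = c f + c g"
      "\<And>q f. q \<in> \<rat> \<Longrightarrow> f \<in> H \<Longrightarrow> c (q *\<^sub>R f) = of_real q * c f"
      "\<And>f. f \<in> H \<Longrightarrow> c (dsc im_unit f) = im_unit * c f"
      "\<And>f. f \<in> H \<Longrightarrow> norm (c f) \<le> r * dnorm (closure D) f" and r: "0 \<le> r"
  obtains y where "y \<in> closure D" "\<And>f. f \<in> H \<Longrightarrow> blinfun_apply f y = c f"
proof -
  let ?Z = "closure D" and ?A = "(\<lambda>f. (f, re_part (c f))) ` H"
  note Z = subspace_closure_rational[OF D(1)]
  note [simp] = linear_add[OF linear_re_part] linear_scale[OF linear_re_part]
  have "rational_subspace ?A"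
    unfolding rational_subspace_def
  proof (intro conjI ballI)
    have H0: "0 \<in> H" using H(1) by (simp add: rational_subspace_def)
    have "c 0 = 0" using c(1)[OF H0 H0] by simp
    then show "0 \<in> ?A" using H0 linear_0[OF linear_re_part] by (force simp: zero_prod_def)
    fix a b assume "a \<in> ?A" "b \<in> ?A"
    then obtain f g where fg: "f \<in> H" "g \<in> H" "a = (f, re_part (c f))" "b = (g, re_part (c g))" by blast
    then have "f + g \<in> H" using H(1) unfolding rational_subspace_def by blast
    then show "a + b \<in> ?A" using c(1) fg by (intro image_eqI[of _ _ "f + g"]) auto
  next
    fix q :: real and a assume q: "q \<in> \<rat>" and "a \<in> ?A"
    then obtain f where f: "f \<in> H" "a = (f, re_part (c f))" by blast
    then have "q *\<^sub>R f \<in> H" using H(1) q unfolding rational_subspace_def by blast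
    then show "q *\<^sub>R a \<in> ?A" using c(2) q f
      by (intro image_eqI[of _ _ "q *\<^sub>R f"]) (auto simp flip: scaleR_conv_of_real)
  qed
  then have sub: "subspace (closure ?A)" by (rule subspace_closure_rational)
  \<comment> \<open>Domination by \<open>r * dnorm\<close> is a closed condition and hence passes to
    the closure of the graph.\<close>
  have "closed {x :: ('y \<Rightarrow>\<^sub>L 'k) \<times> real. snd x \<le> r * dnorm ?Z (fst x)}"
    by (intro closed_Collect_le continuous_intros continuous_on_compose2[OF continuous_dnorm[OF Z]]) auto
  moreover have "?A \<subseteq> {x. snd x \<le> r * dnorm ?Z (fst x)}"
    using order_trans[OF order_trans[OF abs_ge_self abs_re_part_le] c(4)] by auto
  ultimately have "closure ?A \<subseteq> {x. snd x \<le> r * dnorm ?Z (fst x)}"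
    by (intro closure_minimal)
  then have le: "t \<le> r * dnorm ?Z w" if "(w, t) \<in> closure ?A" for w t using that by auto
  note p = dnorm_scaled_seminorm[OF Z r]
  obtain F where F: "linear F" "\<And>x. F x \<le> r * dnorm ?Z x" "\<And>w t. (w, t) \<in> closure ?A \<Longrightarrow> F w = t"
    using hahn_banach[OF dual.seminorm_sublinear[OF p] sub le] by blast
  have FH: "F f = re_part (c f)" if "f \<in> H" for f
    by (rule F(3), rule subsetD[OF closure_subset], rule image_eqI[OF HOL.refl that])
  obtain y where y: "y \<in> ?Z"
      "\<And>f. f \<in> dual \<Longrightarrow> of_real (F f) - im_unit * of_real (F (dsc im_unit f)) = blinfun_apply f y"
    by (rule reflexive_subspace[OF Z refl _ closure_im_unit_closed[OF D(2)] r
        dual.complexify(1)[OF F(1,2) p] dual.complexify(2)[OF F(1,2) p]]) auto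
  show ?thesis
  proof (rule that[OF y(1)])
    fix f assume f: "f \<in> H"
    \<comment> \<open>The extension prescribes only real parts; the imaginary part of
      \<open>c f\<close> is recovered because \<open>H\<close> and \<open>c\<close> are compatible
      with \<open>im_unit\<close>.\<close>
    have "blinfun_apply f y = of_real (re_part (c f)) - im_unit * of_real (re_part (im_unit * c f))"
      using y(2)[of f] f H(2,3) FH c(3) by auto
    then show "blinfun_apply f y = c f" by (simp only: scalar_decomp[of "c f", symmetric])
  qed
qed

text \<open>The exceptional null set depends on the functional, but \<open>u\<close> is separably
  valued, so countably many norming functionals determine its norm.\<close>

lemma AE_norm_le_weak:
  assumes u: "strongly_measurable M u"
    and le: "\<And>f. f \<in> dual \<Longrightarrow> (\<And>x. norm (blinfun_apply f x) \<le> norm x) \<Longrightarrow> AE a in M. norm (f (u a)) \<le> h a"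
  shows "AE a in M. norm (u a) \<le> h a"
proof -
  obtain D where D: "countable D" "\<And>a. a \<in> space M \<Longrightarrow> u a \<in> closure D"
    using strongly_measurable_separable[OF u] by blast
  have "AE a in M. \<forall>d\<in>D. norm (norming d (u a)) \<le> h a"
    by (rule AE_ball_countable'[OF _ D(1)]) (intro le norming)
  with AE_space show ?thesis by eventually_elim (use norm_le_norming D(2) in blast)
qed

text \<open>The bound is assumed for every subspace containing the closure of \<open>D0\<close>,
  because the subspace actually used, generated by a countable enlargement \<open>D\<close> of
  \<open>D0\<close>, is chosen inside the proof.\<close>

theorem weak_representation:
  fixes \<Phi> :: "('y \<Rightarrow>\<^sub>L 'k) \<Rightarrow> 'b \<Rightarrow> 'k" and r :: "'b \<Rightarrow> real"
  assumes refl: "reflexive_space sc" and D0: "countable D0"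
    and add: "\<And>f g. f \<in> dual \<Longrightarrow> g \<in> dual \<Longrightarrow> AE b in M. \<Phi> (f + g) b = \<Phi> f b + \<Phi> g b"
    and scale: "\<And>c f. f \<in> dual \<Longrightarrow> AE b in M. \<Phi> (dsc c f) b = c * \<Phi> f b"
    and meas: "\<And>f. f \<in> dual \<Longrightarrow> \<Phi> f \<in> borel_measurable M"
    and bound: "\<And>f Z. f \<in> dual \<Longrightarrow> subspace Z \<Longrightarrow> closure D0 \<subseteq> Z \<Longrightarrow>
      AE b in M. norm (\<Phi> f b) \<le> r b * dnorm Z f"
    and r: "\<And>b. 0 \<le> r b"
  obtains u where "strongly_measurable M u"
    "\<And>f. f \<in> dual \<Longrightarrow> AE b in M. blinfun_apply f (u b) = \<Phi> f b"
proof -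
  have "\<exists>D. countable D \<and> D0 \<subseteq> D \<and> D \<subseteq> UNIV \<and> rational_subspace D \<and> (\<forall>x\<in>D. sc im_unit x \<in> D)"
    by (rule countable_rational_subspace[OF D0]) auto
  then obtain D where D: "countable D" "D0 \<subseteq> D" "rational_subspace D" "\<And>x. x \<in> D \<Longrightarrow> sc im_unit x \<in> D"
    by blast
  have "\<exists>H. countable H \<and> norming ` D \<subseteq> H \<and> H \<subseteq> dual \<and> rational_subspace H \<and> (\<forall>f\<in>H. dsc im_unit f \<in> H)"
    by (rule countable_rational_subspace[OF countable_image[OF D(1)] _ subspace_dual dsc_dual])
      (use norming(1) in blast)
  then obtain H where H: "countable H" "norming ` D \<subseteq> H" "H \<subseteq> dual" "rational_subspace H"
      "\<And>f. f \<in> H \<Longrightarrow> dsc im_unit f \<in> H"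
    by blast
  let ?Z = "closure D"
  note Z = subspace_closure_rational[OF D(3)]
  have Hdual: "f \<in> dual" if "f \<in> H" for f using H(3) that by blast
  have bound': "AE b in M. norm (\<Phi> f b) \<le> r b * dnorm ?Z f" if "f \<in> dual" for f
    by (rule bound[OF that Z closure_mono[OF D(2)]])
  have scaleR: "AE b in M. \<Phi> (q *\<^sub>R f) b = of_real q * \<Phi> f b" if "f \<in> dual" for q f
    using scale[OF that, of "of_real q"] by (simp add: dual.sc_of_real)
  \<comment> \<open>Countability of \<open>H\<close> and of the rationals places all relations
    needed by \<open>represent_functional\<close> outside a single null set.\<close>
  have "AE b in M. (\<forall>f\<in>H. \<forall>g\<in>H. \<Phi> (f + g) b = \<Phi> f b + \<Phi> g b) \<and>
      (\<forall>q\<in>\<rat>. \<forall>f\<in>H. \<Phi> (q *\<^sub>R f) b = of_real q * \<Phi> f b) \<and>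
      (\<forall>f\<in>H. \<Phi> (dsc im_unit f) b = im_unit * \<Phi> f b) \<and>
      (\<forall>f\<in>H. norm (\<Phi> f b) \<le> r b * dnorm ?Z f)"
    by (intro AE_conjI AE_ball_countable' H(1) countable_rat add scale scaleR bound' Hdual)
  then obtain N where N: "emeasure M N = 0" "N \<in> sets M" and good: "\<And>b. b \<in> space M - N \<Longrightarrow>
      (\<forall>f\<in>H. \<forall>g\<in>H. \<Phi> (f + g) b = \<Phi> f b + \<Phi> g b) \<and>
      (\<forall>q\<in>\<rat>. \<forall>f\<in>H. \<Phi> (q *\<^sub>R f) b = of_real q * \<Phi> f b) \<and>
      (\<forall>f\<in>H. \<Phi> (dsc im_unit f) b = im_unit * \<Phi> f b) \<and>
      (\<forall>f\<in>H. norm (\<Phi> f b) \<le> r b * dnorm ?Z f)"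
    by (elim AE_E) blast
  have "\<exists>y. y \<in> ?Z \<and> (\<forall>f\<in>H. blinfun_apply f y = \<Phi> f b)" if b: "b \<in> space M - N" for b
  proof -
    obtain y where "y \<in> ?Z" "\<And>f. f \<in> H \<Longrightarrow> blinfun_apply f y = \<Phi> f b"
      by (rule represent_functional[OF refl D(3,4) H(4,5,3), of "\<lambda>f. \<Phi> f b" "r b"])
        (use good[OF b] r in auto)
    then show ?thesis by blast
  qed
  then obtain v where v: "\<And>b. b \<in> space M - N \<Longrightarrow> v b \<in> ?Z"
      "\<And>b f. b \<in> space M - N \<Longrightarrow> f \<in> H \<Longrightarrow> blinfun_apply f (v b) = \<Phi> f b" by metis
  \<comment> \<open>The default value 0 lies in \<open>?Z\<close> and is annihilated by every
    functional, so all values of \<open>u\<close> stay in \<open>?Z\<close> and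
    \<open>f (u b)\<close> is \<open>\<Phi> f b\<close> cut off on the measurable set
    \<open>N\<close>.\<close>
  define u where "u = (\<lambda>b. if b \<in> space M - N then v b else 0)"
  have uZ: "u b \<in> ?Z" for b using v(1) subspace_0[OF Z] by (simp add: u_def)
  have uH: "(\<lambda>b. blinfun_apply f (u b)) \<in> borel_measurable M" if "f \<in> H" for f
  proof -
    have "(\<lambda>b. if b \<in> N then 0 else \<Phi> f b) \<in> borel_measurable M"
      using N(2) meas[OF Hdual[OF that]] by (intro measurable_If_set) auto
    moreover have "blinfun_apply f (u b) = (if b \<in> N then 0 else \<Phi> f b)" if "b \<in> space M" for b
      using v(2)[OF _ \<open>f \<in> H\<close>] that by (simp add: u_def)
    ultimately show ?thesis by (simp cong: measurable_cong)
  qed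
  have "strongly_measurable M u"
  proof (rule strongly_measurableI[OF D(1)])
    show "D \<noteq> {}" using D(3) by (auto simp: rational_subspace_def)
    show "u a \<in> closure D" for a by (rule uZ)
    fix e assume e: "e \<in> D"
    have iff: "norm (u b - e) \<le> t \<longleftrightarrow> (\<forall>d\<in>D. norm (norming d (u b) - norming d e) \<le> t)" for b t
    proof
      assume *: "norm (u b - e) \<le> t"
      have "norm (norming d (u b - e)) \<le> t" for d using norming(2)[of d "u b - e"] * by simp
      then show "\<forall>d\<in>D. norm (norming d (u b) - norming d e) \<le> t" by (simp add: blinfun.diff_right)
    next
      assume *: "\<forall>d\<in>D. norm (norming d (u b) - norming d e) \<le> t"
      have "u b - e \<in> ?Z" using subspace_diff[OF Z uZ] e closure_subset by blast
      then show "norm (u b - e) \<le> t" by (rule norm_le_norming) (use * in \<open>simp add: blinfun.diff_right\<close>)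
    qed
    have [measurable]: "(\<lambda>b. norm (norming d (u b) - norming d e)) \<in> borel_measurable M" if "d \<in> D" for d
      by (rule borel_measurable_continuous_on[OF _ uH, of "\<lambda>z. norm (z - norming d e)"])
        (use H(2) that in \<open>auto intro!: continuous_intros\<close>)
    show "(\<lambda>b. norm (u b - e)) \<in> borel_measurable M"
      unfolding borel_measurable_iff_le iff
    proof
      show "{b \<in> space M. \<forall>d\<in>D. norm (norming d (u b) - norming d e) \<le> t} \<in> sets M" for t
      proof -
        have "{b \<in> space M. \<forall>d\<in>D. norm (norming d (u b) - norming d e) \<le> t} =
            (\<Inter>d\<in>D. {b \<in> space M. norm (norming d (u b) - norming d e) \<le> t})"
          using e by blast
        also have "\<dots> \<in> sets M"
        proof (rule sets.countable_INT'[OF D(1)])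
          show "(\<lambda>d. {b \<in> space M. norm (norming d (u b) - norming d e) \<le> t}) ` D \<subseteq> sets M"
            by (intro image_subsetI) measurable
        qed (use e in blast)
        finally show ?thesis .
      qed
    qed
  qed
  moreover have "AE b in M. blinfun_apply f (u b) = \<Phi> f b" if f: "f \<in> dual" for f
  proof -
    \<comment> \<open>An arbitrary \<open>f\<close> is approximated by elements of \<open>H\<close>
      for \<open>dnorm\<close> on \<open>?Z\<close>, the only norm that both \<open>u\<close> and
      the bound on \<open>\<Phi>\<close> see.\<close>
    have "\<exists>g\<in>H. dnorm ?Z (f - g) < 1 / Suc n" for n
      by (rule dnorm_dense[OF refl D(3,4) H(4,5,3,2) f]) auto
    then obtain g where g: "\<And>n. g n \<in> H" "\<And>n. dnorm ?Z (f - g n) < 1 / Suc n" by metis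
    have fg: "f - g n \<in> dual" for n using subspace_diff[OF subspace_dual f Hdual[OF g(1)]] .
    have 1: "AE b in M. \<forall>n. norm (\<Phi> (f - g n) b) \<le> r b * dnorm ?Z (f - g n)"
      unfolding AE_all_countable using bound' fg by blast
    have 2: "AE b in M. \<forall>n. \<Phi> f b = \<Phi> (f - g n) b + \<Phi> (g n) b"
      unfolding AE_all_countable
    proof
      show "AE b in M. \<Phi> f b = \<Phi> (f - g n) b + \<Phi> (g n) b" for n
        using add[OF fg[of n] Hdual[OF g(1)[of n]]] by simp
    qed
    have "AE b in M. b \<notin> N" using N by (intro AE_not_in) auto
    with 1 2 AE_space show ?thesis
    proof eventually_elim
      case (elim b)
      have "norm (blinfun_apply f (u b) - \<Phi> f b) \<le> (norm (u b) + r b) * inverse (Suc n)" for n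
      proof -
        \<comment> \<open>Evaluation at \<open>u b\<close> and \<open>\<Phi>\<close> agree on
          \<open>g n\<close>, so only the error \<open>f - g n\<close> remains, and both of its
          terms are controlled by \<open>dnorm\<close>.\<close>
        have "blinfun_apply f (u b) - \<Phi> f b = blinfun_apply (f - g n) (u b) - \<Phi> (f - g n) b"
          using spec[OF elim(2), of n] elim(3,4) v(2)[OF _ g(1)[of n], of b]
          by (simp add: u_def blinfun.bilinear_simps)
        also have "norm \<dots> \<le> dnorm ?Z (f - g n) * norm (u b) + r b * dnorm ?Z (f - g n)"
          using apply_le_dnorm[OF Z uZ, of "f - g n" b] elim(1)
          by (intro order_trans[OF norm_triangle_ineq4] add_mono) auto
        also have "\<dots> = (norm (u b) + r b) * dnorm ?Z (f - g n)" by (simp add: algebra_simps)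
        also have "\<dots> \<le> (norm (u b) + r b) * inverse (Suc n)"
          using g(2)[of n] r[of b] by (intro mult_left_mono) (auto simp: inverse_eq_divide)
        finally show ?thesis .
      qed
      moreover have "(\<lambda>n. (norm (u b) + r b) * inverse (real (Suc n))) \<longlonglongrightarrow> (norm (u b) + r b) * 0"
        by (intro tendsto_mult tendsto_const LIMSEQ_inverse_real_of_nat)
      ultimately have "norm (blinfun_apply f (u b) - \<Phi> f b) \<le> (norm (u b) + r b) * 0"
        by (intro LIMSEQ_le_const) auto
      then show ?case by simp
    qed
  qed
  ultimately show ?thesis by (rule that)
qed

end

section \<open>Operators on Koethe-Bochner spaces\<close>

lemma banach_space_over_normed_over: "banach_space_over sc \<Longrightarrow> normed_over sc"
  unfolding banach_space_over_def banach_space_over_axioms_def vector_space_def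
    normed_over_def normed_over_axioms_def real_or_complex_space_def by simp

lemma norm_abs_fun [simp]: "norm (abs_fun f a) = norm (f a)"
  by (simp add: abs_fun_def)

lemma measurable_of_real_compose:
  assumes "u \<in> borel_measurable M"
  shows "(\<lambda>a. of_real (u a) :: 'k::real_normed_algebra_1) \<in> borel_measurable M"
  by (rule borel_measurable_continuous_on[OF _ assms]) (intro continuous_intros)

lemma measurable_abs_fun: "f \<in> borel_measurable M \<Longrightarrow> abs_fun f \<in> borel_measurable M"
  unfolding abs_fun_def
  by (intro measurable_of_real_compose borel_measurable_continuous_on[of norm]) (auto intro: continuous_intros)

lemma
  assumes "banach_function_space E"
  shows bfs_measurable: "f \<in> fs_carrier E \<Longrightarrow> f \<in> borel_measurable (fs_measure E)"
    and bfs_zero: "(\<lambda>a. 0) \<in> fs_carrier E"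
    and bfs_add: "f \<in> fs_carrier E \<Longrightarrow> g \<in> fs_carrier E \<Longrightarrow> (\<lambda>a. f a + g a) \<in> fs_carrier E"
    and bfs_scale: "f \<in> fs_carrier E \<Longrightarrow> (\<lambda>a. c * f a) \<in> fs_carrier E"
    and bfs_ideal: "f \<in> borel_measurable (fs_measure E) \<Longrightarrow> g \<in> fs_carrier E \<Longrightarrow>
      (AE a in fs_measure E. norm (f a) \<le> norm (g a)) \<Longrightarrow> f \<in> fs_carrier E"
    and bfs_norm_mono: "f \<in> fs_carrier E \<Longrightarrow> g \<in> fs_carrier E \<Longrightarrow>
      (AE a in fs_measure E. norm (f a) \<le> norm (g a)) \<Longrightarrow> fs_norm E f \<le> fs_norm E g"
    and bfs_norm_zero: "fs_norm E (\<lambda>a. 0) = 0"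
  using assms unfolding banach_function_space_def by (blast | simp)+

lemma bfs_norm_nonneg:
  assumes "banach_function_space E" "f \<in> fs_carrier E" shows "0 \<le> fs_norm E f"
  using bfs_norm_mono[OF assms(1) bfs_zero[OF assms(1)] assms(2)] bfs_norm_zero[OF assms(1)] by simp

lemma bfs_abs_fun: "banach_function_space E \<Longrightarrow> f \<in> fs_carrier E \<Longrightarrow> abs_fun f \<in> fs_carrier E"
  by (rule bfs_ideal) (auto intro: measurable_abs_fun bfs_measurable)

lemma nonneg_Reals_iff_of_real: "z \<in> \<real>\<^sub>\<ge>\<^sub>0 \<longleftrightarrow> z = of_real (norm z)"
  for z :: "'k::real_normed_algebra_1"
proof
  assume "z = of_real (norm z)"
  then show "z \<in> \<real>\<^sub>\<ge>\<^sub>0" unfolding nonneg_Reals_def by (blast intro: norm_ge_zero)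
qed (auto simp: nonneg_Reals_def)

lemma linear_operatorD:
  assumes "linear_operator sv sw E G T"
  shows "f \<in> fs_carrier E \<Longrightarrow> T f \<in> fs_carrier G"
    and "f \<in> fs_carrier E \<Longrightarrow> g \<in> fs_carrier E \<Longrightarrow> AE a in fs_measure E. f a = g a \<Longrightarrow>
      AE b in fs_measure G. T f b = T g b"
    and "f \<in> fs_carrier E \<Longrightarrow> g \<in> fs_carrier E \<Longrightarrow>
      AE b in fs_measure G. T (\<lambda>a. f a + g a) b = T f b + T g b"
    and "f \<in> fs_carrier E \<Longrightarrow> AE b in fs_measure G. T (\<lambda>a. sv c (f a)) b = sw c (T f b)"
  using assms unfolding linear_operator_def by auto

lemma positive_operator_linear: "positive_operator E G R \<Longrightarrow> linear_operator (*) (*) E G R"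
  by (simp add: positive_operator_def bounded_operator_def)

text \<open>The value of \<open>R\<close> at \<open>v\<close> is the sum of its values at
  \<open>v - u\<close> and at \<open>u\<close>. Both are nonnegative reals almost everywhere, so
  their norms add.\<close>

lemma positive_operator_mono:
  fixes E :: "('a, 'k::real_or_complex) fun_space" and u v :: "'a \<Rightarrow> real"
  assumes E: "banach_function_space E" and R: "positive_operator E G R"
    and u: "(\<lambda>a. of_real (u a)) \<in> fs_carrier E" and v: "(\<lambda>a. of_real (v a)) \<in> fs_carrier E"
    and uv: "AE a in fs_measure E. 0 \<le> u a" "AE a in fs_measure E. u a \<le> v a"
  shows "AE b in fs_measure G. norm (R (\<lambda>a. of_real (u a)) b) \<le> norm (R (\<lambda>a. of_real (v a)) b)"
proof -
  let ?w = "\<lambda>a. of_real (v a - u a) :: 'k"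
  have w: "?w \<in> fs_carrier E"
    using bfs_add[OF E v bfs_scale[OF E u, of "- 1"]] by simp
  have pos: "AE b in fs_measure G. R f b = of_real (norm (R f b))"
    if "f \<in> fs_carrier E" "AE a in fs_measure E. f a \<in> \<real>\<^sub>\<ge>\<^sub>0" for f
    using R that unfolding positive_operator_def nonneg_Reals_iff_of_real[symmetric] by blast
  have "AE a in fs_measure E. (of_real (u a) :: 'k) \<in> \<real>\<^sub>\<ge>\<^sub>0" "AE a in fs_measure E. ?w a \<in> \<real>\<^sub>\<ge>\<^sub>0"
    using uv by (auto simp: nonneg_Reals_iff_of_real simp flip: of_real_diff)
  with pos u w have "AE b in fs_measure G. R (\<lambda>a. of_real (u a)) b = of_real (norm (R (\<lambda>a. of_real (u a)) b))"
    "AE b in fs_measure G. R ?w b = of_real (norm (R ?w b))" by blast+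
  moreover have "AE b in fs_measure G. R (\<lambda>a. of_real (v a)) b = R ?w b + R (\<lambda>a. of_real (u a)) b"
    using linear_operatorD(3)[OF positive_operator_linear[OF R] w u] by simp
  ultimately show ?thesis
  proof eventually_elim
    case (elim b)
    have "R (\<lambda>a. of_real (v a)) b = of_real (norm (R ?w b) + norm (R (\<lambda>a. of_real (u a)) b))"
      using elim by simp
    then have "norm (R (\<lambda>a. of_real (v a)) b) = \<bar>norm (R ?w b) + norm (R (\<lambda>a. of_real (u a)) b)\<bar>"
      by (simp only: norm_of_real)
    then show ?case by simp
  qed
qed

lemma positive_operator_le_scaled:
  fixes E :: "('a, 'k::real_or_complex) fun_space" and e :: "'a \<Rightarrow> 'y::real_normed_vector"
  assumes E: "banach_function_space E" and R: "positive_operator E G R"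
    and h: "h \<in> fs_carrier E" and e: "abs_fun e \<in> fs_carrier E" and t: "0 \<le> t"
    and le: "AE a in fs_measure E. norm (h a) \<le> t * norm (e a)"
  shows "AE b in fs_measure G. norm (R (abs_fun h) b) \<le> t * norm (R (abs_fun e) b)"
proof -
  have v: "(\<lambda>a. of_real (t * norm (e a))) \<in> fs_carrier E"
    using bfs_scale[OF E e, of "of_real t"] by (simp add: abs_fun_def)
  have "AE b in fs_measure G. norm (R (\<lambda>a. of_real (norm (h a))) b)
      \<le> norm (R (\<lambda>a. of_real (t * norm (e a))) b)"
    by (rule positive_operator_mono[OF E R _ v _ le]) (use bfs_abs_fun[OF E h] in \<open>auto simp: abs_fun_def\<close>)
  moreover have "AE b in fs_measure G. R (\<lambda>a. of_real (t * norm (e a))) b = of_real t * R (abs_fun e) b"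
    using linear_operatorD(4)[OF positive_operator_linear[OF R] e, of "of_real t"] by (simp add: abs_fun_def)
  ultimately show ?thesis
    by eventually_elim (use t in \<open>simp add: abs_fun_def norm_mult\<close>)
qed

text \<open>\<open>R (abs_fun e) b\<close> is the sum of two nonnegative reals, one of which is
  \<open>norm (T e b)\<close>.\<close>

lemma dominates_le:
  assumes "dominates E G R T" "e \<in> fs_carrier E"
  shows "AE b in fs_measure G. norm (T e b) \<le> norm (R (abs_fun e) b)"
proof -
  have "AE b in fs_measure G. R (abs_fun e) b - abs_fun (T e) b \<in> \<real>\<^sub>\<ge>\<^sub>0"
    using assms by (simp add: dominates_def)
  then show ?thesis
  proof eventually_elim
    case (elim b)
    then have "R (abs_fun e) b = of_real (norm (R (abs_fun e) b - abs_fun (T e) b) + norm (T e b))"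
      unfolding nonneg_Reals_iff_of_real by (simp add: abs_fun_def algebra_simps)
    then have "norm (R (abs_fun e) b) = \<bar>norm (R (abs_fun e) b - abs_fun (T e) b) + norm (T e b)\<bar>"
      by (metis norm_of_real)
    then show ?case by simp
  qed
qed

lemma dominates_positive: "dominates E G R T \<Longrightarrow> positive_operator E G R"
  by (simp add: dominates_def)

lemma kothe_bochner_simps [simp]:
  "fs_measure (kothe_bochner E) = fs_measure E"
  "f \<in> fs_carrier (kothe_bochner E) \<longleftrightarrow> strongly_measurable (fs_measure E) f \<and> abs_fun f \<in> fs_carrier E"
  "fs_norm (kothe_bochner E) f = fs_norm E (abs_fun f)"
  by (simp_all add: kothe_bochner_def)

context normed_over
begin

text \<open>The weak norm bound with \<open>h = 0\<close>, applied to the difference. This is the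
  source of uniqueness, and through it of the linearity of the extension.\<close>

lemma AE_eq_weak:
  assumes u: "strongly_measurable M u" and v: "strongly_measurable M v"
    and eq: "\<And>f. f \<in> dual \<Longrightarrow> AE a in M. blinfun_apply f (u a) = f (v a)"
  shows "AE a in M. u a = v a"
proof -
  have "strongly_measurable M (\<lambda>a. u a + - v a)"
    by (intro strongly_measurable_add u strongly_measurable_continuous[OF v]) (intro continuous_intros)
  then have "AE a in M. norm (u a + - v a) \<le> 0"
  proof (rule AE_norm_le_weak)
    fix f assume "f \<in> dual"
    from eq[OF this] show "AE a in M. norm (blinfun_apply f (u a + - v a)) \<le> 0"
      by eventually_elim (simp add: blinfun.bilinear_simps)
  qed
  then show ?thesis by simp
qed

section \<open>Extending a dominated operator at a single vector-valued function\<close>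

context
  fixes E :: "('a, 'k) fun_space" and G :: "('b, 'k) fun_space"
    and T :: "('a \<Rightarrow> 'k) \<Rightarrow> 'b \<Rightarrow> 'k"
  assumes E: "banach_function_space E" and G: "banach_function_space G"
    and T: "linear_operator (*) (*) E G T"
begin

lemma dual_apply_carrier:
  assumes e: "e \<in> fs_carrier (kothe_bochner E)"
  shows "(\<lambda>a. blinfun_apply f (e a)) \<in> fs_carrier E"
proof (rule bfs_ideal[OF E])
  show "(\<lambda>a. of_real (norm f) * abs_fun e a) \<in> fs_carrier E" using bfs_scale[OF E] e by simp
  show "(\<lambda>a. blinfun_apply f (e a)) \<in> borel_measurable (fs_measure E)"
    by (rule borel_measurable_continuous_on[OF _ strongly_measurable_borel])
      (use e in \<open>auto intro!: continuous_intros\<close>)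
qed (auto simp: norm_mult norm_blinfun)

text \<open>Domination gives \<open>R\<close> applied to the modulus of \<open>f (e a)\<close> as a
  bound, and positivity compares this with \<open>t * R (abs_fun e)\<close>. The factor
  \<open>t\<close> will be \<open>dnorm Z f\<close> for existence and 1 for the norm
  estimate.\<close>

lemma dominated_weak_bound:
  assumes R: "dominates E G R T" and e: "e \<in> fs_carrier (kothe_bochner E)" and t: "0 \<le> t"
    and le: "\<And>a. a \<in> space (fs_measure E) \<Longrightarrow> norm (blinfun_apply f (e a)) \<le> t * norm (e a)"
  shows "AE b in fs_measure G. norm (T (\<lambda>a. f (e a)) b) \<le> t * norm (R (abs_fun e) b)"
proof -
  have "AE b in fs_measure G. norm (R (abs_fun (\<lambda>a. blinfun_apply f (e a))) b) \<le> t * norm (R (abs_fun e) b)"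
    by (rule positive_operator_le_scaled[OF E dominates_positive[OF R] dual_apply_carrier[OF e] _ t])
      (use e le in auto)
  with dominates_le[OF R dual_apply_carrier[OF e, of f]] show ?thesis
    by eventually_elim (rule order_trans)
qed

text \<open>The values of \<open>e\<close> lie in the closure of a countable set, so only the
  restriction of \<open>f\<close> to a subspace \<open>Z\<close> containing this closure matters;
  this supplies the \<open>dnorm\<close> bound of \<open>weak_representation\<close>.\<close>

lemma weak_extension:
  assumes refl: "reflexive_space sc" and R: "dominates E G R T" and e: "e \<in> fs_carrier (kothe_bochner E)"
  obtains u where "strongly_measurable (fs_measure G) u"
    "\<And>f. f \<in> dual \<Longrightarrow> AE b in fs_measure G. blinfun_apply f (u b) = T (\<lambda>a. f (e a)) b"
proof -
  obtain D where D: "countable D" "\<And>a. a \<in> space (fs_measure E) \<Longrightarrow> e a \<in> closure D"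
    using strongly_measurable_separable e by auto
  show ?thesis
  proof (rule weak_representation[OF refl D(1), where M = "fs_measure G" and
        \<Phi> = "\<lambda>f. T (\<lambda>a. blinfun_apply f (e a))" and r = "\<lambda>b. norm (R (abs_fun e) b)"])
    show "AE b in fs_measure G. T (\<lambda>a. blinfun_apply (f + g) (e a)) b =
        T (\<lambda>a. f (e a)) b + T (\<lambda>a. g (e a)) b" for f g :: "'y \<Rightarrow>\<^sub>L 'k"
      using linear_operatorD(3)[OF T dual_apply_carrier[OF e] dual_apply_carrier[OF e], of f g]
      by (simp add: blinfun.add_left)
    show "AE b in fs_measure G. T (\<lambda>a. dsc c f (e a)) b = c * T (\<lambda>a. f (e a)) b" for c and f :: "'y \<Rightarrow>\<^sub>L 'k"
      using linear_operatorD(4)[OF T dual_apply_carrier[OF e], of c f] by simp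
    show "T (\<lambda>a. f (e a)) \<in> borel_measurable (fs_measure G)" for f :: "'y \<Rightarrow>\<^sub>L 'k"
      by (rule bfs_measurable[OF G linear_operatorD(1)[OF T dual_apply_carrier[OF e]]])
    show "AE b in fs_measure G. norm (T (\<lambda>a. blinfun_apply f (e a)) b) \<le> norm (R (abs_fun e) b) * dnorm Z f"
      if Z: "subspace Z" "closure D \<subseteq> Z" for f Z
    proof -
      have "norm (blinfun_apply f (e a)) \<le> dnorm Z f * norm (e a)" if "a \<in> space (fs_measure E)" for a
        using apply_le_dnorm[OF Z(1)] D(2)[OF that] Z(2) by blast
      then show ?thesis
        using dominated_weak_bound[OF R e dnorm_nonneg[OF Z(1)]] by (simp add: mult.commute)
    qed
  qed (use that in auto)
qed

text \<open>\<open>R\<close> may be any dominating operator, unrelated to the construction of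
  \<open>u\<close>. This freedom allows the infimum over all of them later.\<close>

lemma weak_extension_norm_le:
  assumes R: "dominates E G R T" and e: "e \<in> fs_carrier (kothe_bochner E)"
    and u: "strongly_measurable (fs_measure G) u"
      "\<And>f. f \<in> dual \<Longrightarrow> AE b in fs_measure G. blinfun_apply f (u b) = T (\<lambda>a. f (e a)) b"
  shows "AE b in fs_measure G. norm (u b) \<le> norm (R (abs_fun e) b)"
    and "u \<in> fs_carrier (kothe_bochner G)"
    and "fs_norm (kothe_bochner G) u \<le> fs_norm G (R (abs_fun e))"
proof -
  show le: "AE b in fs_measure G. norm (u b) \<le> norm (R (abs_fun e) b)"
  proof (rule AE_norm_le_weak[OF u(1)])
    fix f assume f: "f \<in> dual" and "\<And>x. norm (blinfun_apply f x) \<le> norm x"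
    then have "AE b in fs_measure G. norm (T (\<lambda>a. f (e a)) b) \<le> 1 * norm (R (abs_fun e) b)"
      by (intro dominated_weak_bound[OF R e]) auto
    with u(2)[OF f] show "AE b in fs_measure G. norm (f (u b)) \<le> norm (R (abs_fun e) b)"
      by eventually_elim simp
  qed
  have Re: "R (abs_fun e) \<in> fs_carrier G"
    using linear_operatorD(1)[OF positive_operator_linear[OF dominates_positive[OF R]]] e by auto
  have "abs_fun u \<in> fs_carrier G"
    by (rule bfs_ideal[OF G measurable_abs_fun[OF strongly_measurable_borel[OF u(1)]] Re]) (use le in simp)
  then show "u \<in> fs_carrier (kothe_bochner G)" "fs_norm (kothe_bochner G) u \<le> fs_norm G (R (abs_fun e))"
    using u(1) bfs_norm_mono[OF G _ Re, of "abs_fun u"] le by auto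
qed

end

lemma kothe_bochner_add:
  assumes E: "banach_function_space E"
    and fg: "f \<in> fs_carrier (kothe_bochner E)" "g \<in> fs_carrier (kothe_bochner E)"
  shows "(\<lambda>a. f a + g a :: 'y) \<in> fs_carrier (kothe_bochner (E :: ('a, 'k) fun_space))"
proof -
  have sm: "strongly_measurable (fs_measure E) (\<lambda>a. f a + g a)" using fg by (auto intro: strongly_measurable_add)
  have sum: "(\<lambda>a. abs_fun f a + abs_fun g a) \<in> fs_carrier E" using bfs_add[OF E] fg by simp
  have "norm (abs_fun f a + abs_fun g a :: 'k) = norm (f a) + norm (g a)" for a
    by (simp add: abs_fun_def flip: of_real_add)
  then have "abs_fun (\<lambda>a. f a + g a) \<in> fs_carrier E"
    by (intro bfs_ideal[OF E measurable_abs_fun[OF strongly_measurable_borel[OF sm]] sum] AE_I2)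
      (simp add: norm_triangle_ineq)
  then show ?thesis using sm by simp
qed

lemma kothe_bochner_scale:
  assumes E: "banach_function_space E" and f: "f \<in> fs_carrier (kothe_bochner E)"
  shows "(\<lambda>a. sc c (f a)) \<in> fs_carrier (kothe_bochner (E :: ('a, 'k) fun_space))"
proof -
  have "strongly_measurable (fs_measure E) (\<lambda>a. sc c (f a))"
    by (rule strongly_measurable_continuous[OF _ linear_continuous_on[OF bounded_linear_sc]]) (use f in simp)
  moreover have "abs_fun (\<lambda>a. sc c (f a)) = (\<lambda>a. of_real (norm c) * abs_fun f a :: 'k)"
    by (simp add: abs_fun_def norm_sc fun_eq_iff)
  ultimately show ?thesis using f bfs_scale[OF E] by simp
qed

end

section \<open>The extended operator, its norm and its uniqueness\<close>

theorem theorem3p6: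
  fixes E :: "('a, 'k::real_or_complex) fun_space"
    and G :: "('b, 'k) fun_space"
    and T :: "('a \<Rightarrow> 'k) \<Rightarrow> 'b \<Rightarrow> 'k"
    and sc :: "'k \<Rightarrow> 'y::banach \<Rightarrow> 'y"
  assumes "banach_function_space E" and "banach_function_space G"
    and "T \<in> dominated_operators E G"
    and "banach_space_over sc" and "reflexive_space sc"
  shows "\<exists>S. vector_valued_extension sc E G T S \<and>
           operator_norm (kothe_bochner E :: ('a, 'y) fun_space) (kothe_bochner G) S
             \<le> dominated_norm E G T \<and>
           (\<forall>S'. vector_valued_extension sc E G T S' \<longrightarrow>
              (\<forall>e\<in>fs_carrier (kothe_bochner E). AE b in fs_measure G. S' e b = S e b))"
proof -
  interpret normed_over sc by (rule banach_space_over_normed_over) fact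
  note E = assms(1) and G = assms(2)
  let ?E = "kothe_bochner E :: ('a, 'y) fun_space" and ?G = "kothe_bochner G :: ('b, 'y) fun_space"
  have T: "linear_operator (*) (*) E G T" and "\<exists>R. dominates E G R T"
    using assms(3) by (auto simp: dominated_operators_def)
  then obtain R0 where R0: "dominates E G R0 T" by blast
  have "\<exists>u. strongly_measurable (fs_measure G) u \<and>
      (\<forall>f\<in>dual. AE b in fs_measure G. blinfun_apply f (u b) = T (\<lambda>a. f (e a)) b)"
    if "e \<in> fs_carrier ?E" for e
    using weak_extension[OF E G T assms(5) R0 that] by metis
  \<comment> \<open>\<open>S e\<close> is an arbitrary representative for each \<open>e\<close>.
    Well-definedness on classes, additivity and homogeneity therefore hold almost everywhere and are
    all deduced from uniqueness of the weak representation.\<close>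
  then obtain S where S: "\<And>e. e \<in> fs_carrier ?E \<Longrightarrow> strongly_measurable (fs_measure G) (S e)"
      "\<And>e f. e \<in> fs_carrier ?E \<Longrightarrow> f \<in> dual \<Longrightarrow>
        AE b in fs_measure G. blinfun_apply f (S e b) = T (\<lambda>a. f (e a)) b"
    by metis
  note S_bound = weak_extension_norm_le[OF E G T _ _ S(1) S(2)]
  have unique: "AE b in fs_measure G. u b = S e b"
    if "e \<in> fs_carrier ?E" "strongly_measurable (fs_measure G) u"
      "\<And>f. f \<in> dual \<Longrightarrow> AE b in fs_measure G. blinfun_apply f (u b) = T (\<lambda>a. f (e a)) b" for e u
  proof (rule AE_eq_weak[OF that(2) S(1)[OF that(1)]])
    fix f assume f: "f \<in> dual"
    show "AE b in fs_measure G. blinfun_apply f (u b) = f (S e b)"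
      using that(3)[OF f] S(2)[OF that(1) f] by eventually_elim simp
  qed
  have lin: "linear_operator sc sc ?E ?G S"
    unfolding linear_operator_def
  proof (intro conjI ballI allI impI)
    show "S e \<in> fs_carrier ?G" if "e \<in> fs_carrier ?E" for e
      using S_bound(2)[OF R0 that] that by blast
  next
    fix e e' assume e: "e \<in> fs_carrier ?E" "e' \<in> fs_carrier ?E" and "AE a in fs_measure ?E. e a = e' a"
    then have "AE a in fs_measure E. e a = e' a" unfolding kothe_bochner_simps(1) by blast
    then have eq: "AE a in fs_measure E. blinfun_apply f (e a) = f (e' a)" for f :: "'y \<Rightarrow>\<^sub>L 'k"
      by eventually_elim simp
    have "AE b in fs_measure G. S e b = S e' b"
    \<comment> \<open>\<open>S e\<close> is tested as a candidate for \<open>e'\<close>, since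
      \<open>T\<close> does not distinguish the two scalar functions up to null sets.\<close>
    proof (rule unique[OF e(2) S(1)[OF e(1)]])
      fix f assume f: "f \<in> dual"
      show "AE b in fs_measure G. blinfun_apply f (S e b) = T (\<lambda>a. f (e' a)) b"
        using S(2)[OF e(1) f] linear_operatorD(2)[OF T dual_apply_carrier[OF E G T e(1)] dual_apply_carrier[OF E G T e(2)] eq]
        by eventually_elim simp
    qed
    then show "AE b in fs_measure ?G. S e b = S e' b"
      unfolding kothe_bochner_simps(1) by eventually_elim simp
  next
    fix e e' assume e: "e \<in> fs_carrier ?E" "e' \<in> fs_carrier ?E"
    have "AE b in fs_measure G. S e b + S e' b = S (\<lambda>a. e a + e' a) b"
    proof (rule unique[OF kothe_bochner_add[OF E e] strongly_measurable_add[OF S(1)[OF e(1)] S(1)[OF e(2)]]])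
      fix f assume f: "f \<in> dual"
      show "AE b in fs_measure G. blinfun_apply f (S e b + S e' b) = T (\<lambda>a. f (e a + e' a)) b"
        using S(2)[OF e(1) f] S(2)[OF e(2) f]
          linear_operatorD(3)[OF T dual_apply_carrier[OF E G T e(1)] dual_apply_carrier[OF E G T e(2)], of f f]
        by eventually_elim (simp add: blinfun.add_right)
    qed
    then show "AE b in fs_measure ?G. S (\<lambda>a. e a + e' a) b = S e b + S e' b"
      unfolding kothe_bochner_simps(1) by eventually_elim simp
  next
    fix c e assume e: "e \<in> fs_carrier ?E"
    have "AE b in fs_measure G. sc c (S e b) = S (\<lambda>a. sc c (e a)) b"
    proof (rule unique[OF kothe_bochner_scale[OF E e] strongly_measurable_continuous[OF S(1)[OF e]
            linear_continuous_on[OF bounded_linear_sc]]])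
      fix f assume f: "f \<in> dual"
      show "AE b in fs_measure G. blinfun_apply f (sc c (S e b)) = T (\<lambda>a. f (sc c (e a))) b"
        using S(2)[OF e f] linear_operatorD(4)[OF T dual_apply_carrier[OF E G T e], of c f]
        by eventually_elim (use f in \<open>simp add: dual_def\<close>)
    qed
    then show "AE b in fs_measure ?G. S (\<lambda>a. sc c (e a)) b = sc c (S e b)" unfolding kothe_bochner_simps(1) by eventually_elim simp
  qed
  obtain C where C: "\<And>f. f \<in> fs_carrier E \<Longrightarrow> fs_norm G (R0 f) \<le> C * fs_norm E f"
    using dominates_positive[OF R0] by (auto simp: positive_operator_def bounded_operator_def)
  have "bounded_operator sc sc ?E ?G S"
    unfolding bounded_operator_def
  proof (intro conjI exI ballI)
    show "fs_norm ?G (S e) \<le> C * fs_norm ?E e" if "e \<in> fs_carrier ?E" for e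
      using S_bound(3)[OF R0 that] C[of "abs_fun e"] that by fastforce
  qed (rule lin)
  then have ext: "vector_valued_extension sc E G T S"
    using S(2) by (auto simp: vector_valued_extension_def dual_space_iff simp del: kothe_bochner_simps)
  have norm: "operator_norm ?E ?G S \<le> dominated_norm E G T"
    unfolding dominated_norm_def
  proof (rule cINF_greatest)
    \<comment> \<open>\<open>S\<close> was built from \<open>R0\<close>, but its pointwise bound
      holds for each dominating \<open>R\<close>; bounding the operator norm by each of them gives
      the infimum.\<close>
    fix R assume "R \<in> {R. dominates E G R T}"
    then have R: "dominates E G R T" by simp
    then obtain C where C: "\<And>f. f \<in> fs_carrier E \<Longrightarrow> fs_norm G (R f) \<le> C * fs_norm E f"
      using dominates_positive[OF R] by (auto simp: positive_operator_def bounded_operator_def)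
    \<comment> \<open>Boundedness of \<open>R\<close> makes the real supremum defining its operator
      norm a genuine upper bound.\<close>
    have bdd: "bdd_above ((\<lambda>f. fs_norm G (R f)) ` {f \<in> fs_carrier E. fs_norm E f \<le> 1})"
    proof (rule bdd_aboveI2)
      fix f assume f: "f \<in> {f \<in> fs_carrier E. fs_norm E f \<le> 1}"
      have "fs_norm G (R f) \<le> C * fs_norm E f" using C f by simp
      also have "\<dots> \<le> \<bar>C\<bar> * 1"
        using f bfs_norm_nonneg[OF E, of f] by (intro mult_mono) auto
      finally show "fs_norm G (R f) \<le> \<bar>C\<bar> * 1" .
    qed
    show "operator_norm ?E ?G S \<le> operator_norm E G R"
      unfolding operator_norm_def
    proof (rule cSUP_least)
      have "abs_fun (\<lambda>a::'a. 0 :: 'y) = (\<lambda>a. 0 :: 'k)" by (simp add: abs_fun_def)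
      moreover have "strongly_measurable (fs_measure E) (\<lambda>a. 0 :: 'y)"
        unfolding strongly_measurable_def by (intro exI[of _ "\<lambda>n a. 0"]) auto
      ultimately have "(\<lambda>a. 0) \<in> {e \<in> fs_carrier ?E. fs_norm ?E e \<le> 1}"
        using bfs_zero[OF E] bfs_norm_zero[OF E] by simp
      then show "{e \<in> fs_carrier ?E. fs_norm ?E e \<le> 1} \<noteq> {}" by blast
    next
      fix e assume e: "e \<in> {e \<in> fs_carrier ?E. fs_norm ?E e \<le> 1}"
      then have "fs_norm ?G (S e) \<le> fs_norm G (R (abs_fun e))" using S_bound(3)[OF R, of e] by blast
      also have "\<dots> \<le> (SUP f\<in>{f \<in> fs_carrier E. fs_norm E f \<le> 1}. fs_norm G (R f))"
        \<comment> \<open>The norm of \<open>e\<close> is by definition that of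
          \<open>abs_fun e\<close>, so \<open>abs_fun e\<close> belongs to the unit ball of
          \<open>E\<close>.\<close>
        by (rule cSUP_upper[OF _ bdd]) (use e in simp)
      finally show "fs_norm ?G (S e) \<le> (SUP f\<in>{f \<in> fs_carrier E. fs_norm E f \<le> 1}. fs_norm G (R f))" .
    qed
  qed (use R0 in blast)
  have "AE b in fs_measure G. S' e b = S e b"
    if S': "vector_valued_extension sc E G T S'" and e: "e \<in> fs_carrier ?E" for S' e
  proof (rule unique[OF e])
    have "S' e \<in> fs_carrier ?G"
      using S' e unfolding vector_valued_extension_def bounded_operator_def linear_operator_def by blast
    then show "strongly_measurable (fs_measure G) (S' e)" by simp
    show "AE b in fs_measure G. blinfun_apply f (S' e b) = T (\<lambda>a. f (e a)) b" if "f \<in> dual" for f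
    proof -
      have "blinfun_apply f \<in> dual_space sc" using that dual_space_iff by blast
      then show ?thesis using S' e by (simp add: vector_valued_extension_def)
    qed
  qed
  then show ?thesis using ext norm by blast
qed

end
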